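(* Let $\mathbb{G}$ be a compact Hausdorff group acting continuously on a compact Hausdorff space $X$, let $$X_{(1)}:=\{x\in X : \mathbb{G}_x=\{1\}\}\subseteq X,$$ and let $x\in\overline{X_{(1)}}$ (closure in $X$). If an irreducible representation $\alpha$ of $\mathbb{G}$ restricts non-trivially to $\mathbb{G}_x$ (that is, $\mathbb{G}_x$ does not act trivially on the carrier space of $\alpha$), then the isotypic component $C(X)_{\alpha}$ is not finitely generated as a $C(X)^{\mathbb{G}}$-module.
   Context: $\mathbb{G}_x=\{s\in\mathbb{G}: s\triangleright x=x\}$ is the isotropy group of $x$. $C(X)$ is the $C^*$-algebra of complex-valued continuous functions on $X$, with $\mathbb{G}$ acting by $(s\triangleright f)(x)=f(s^{-1}\triangleright x)$; $C(X)^{\mathbb{G}}\cong C(X/\mathbb{G})$ is the subalgebra of $\mathbb{G}$-invariant functions. The $\alpha$-isotypic component is $C(X)_{\alpha}=\{f\in C(X): \operatorname{span}(\mathbb{G}f)\cong\alpha^{n}\text{ for some integer } n\ge 0\}$. *)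

theory Defs
  imports "HOL-Analysis.Analysis" "HOL-Library.Function_Algebras"
begin

text \<open>
  Topological groups are rendered by the type class \<^class>\<open>topological_group_add\<close>, whose underlying
  class \<^class>\<open>group_add\<close> is not commutative: the group law is written \<open>s + t\<close>, the neutral
  element \<open>0\<close> and the inverse \<open>- s\<close>, but no commutativity is implied.
  Compactness is imposed in the form \<open>compact UNIV\<close>.
\<close>

definition continuous_action ::
    "('g::topological_group_add \<Rightarrow> 'x::topological_space \<Rightarrow> 'x) \<Rightarrow> bool" where
  "continuous_action act \<longleftrightarrow>
     (\<forall>x. act 0 x = x) \<and>
     (\<forall>s t x. act (s + t) x = act s (act t x)) \<and>
     continuous_on UNIV (\<lambda>(s, x). act s x)"

definition isotropy :: "('g \<Rightarrow> 'x \<Rightarrow> 'x) \<Rightarrow> 'x \<Rightarrow> 'g set" where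
  "isotropy act x = {s. act s x = x}"

definition free_points :: "('g::zero \<Rightarrow> 'x \<Rightarrow> 'x) \<Rightarrow> 'x set" where
  "free_points act = {x. isotropy act x = {0}}"


text \<open>
  A finite-dimensional representation is given in coordinates, on the carrier space
  \<open>complex ^ 'n\<close>, which is never the zero space because index types are nonempty.
\<close>

definition representation ::
    "('g::topological_group_add \<Rightarrow> complex ^ 'n ^ 'n) \<Rightarrow> bool" where
  "representation \<alpha> \<longleftrightarrow>
     \<alpha> 0 = mat 1 \<and> (\<forall>s t. \<alpha> (s + t) = \<alpha> s ** \<alpha> t) \<and> continuous_on UNIV \<alpha>"

definition irreducible_representation ::
    "('g::topological_group_add \<Rightarrow> complex ^ 'n ^ 'n) \<Rightarrow> bool" where
  "irreducible_representation \<alpha> \<longleftrightarrow>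
     representation \<alpha> \<and>
     (\<forall>V. vec.subspace V \<and> (\<forall>s. \<forall>v\<in>V. \<alpha> s *v v \<in> V) \<longrightarrow> V = {0} \<or> V = UNIV)"

definition acts_trivially :: "('g \<Rightarrow> complex ^ 'n ^ 'n) \<Rightarrow> 'g set \<Rightarrow> bool" where
  "acts_trivially \<alpha> H \<longleftrightarrow> (\<forall>s\<in>H. \<forall>v. \<alpha> s *v v = v)"

text \<open>
  Isomorphism of two linear actions \<open>\<rho>\<close>, \<open>\<sigma>\<close> of \<open>'g\<close> on complex subspaces \<open>V\<close>, \<open>W\<close> of vector
  spaces with scalar multiplications \<open>scaleV\<close>, \<open>scaleW\<close>.
\<close>

definition rep_isomorphic ::
    "(complex \<Rightarrow> 'v::ab_group_add \<Rightarrow> 'v) \<Rightarrow> 'v set \<Rightarrow> ('g \<Rightarrow> 'v \<Rightarrow> 'v) \<Rightarrow>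
     (complex \<Rightarrow> 'w::ab_group_add \<Rightarrow> 'w) \<Rightarrow> 'w set \<Rightarrow> ('g \<Rightarrow> 'w \<Rightarrow> 'w) \<Rightarrow> bool" where
  "rep_isomorphic scaleV V \<rho> scaleW W \<sigma> \<longleftrightarrow>
     (\<exists>\<Phi>. bij_betw \<Phi> V W \<and>
          (\<forall>u\<in>V. \<forall>v\<in>V. \<Phi> (u + v) = \<Phi> u + \<Phi> v) \<and>
          (\<forall>c. \<forall>v\<in>V. \<Phi> (scaleV c v) = scaleW c (\<Phi> v)) \<and>
          (\<forall>s. \<forall>v\<in>V. \<Phi> (\<rho> s v) = \<sigma> s (\<Phi> v)))"

text \<open>
  The direct sum of \<open>n\<close> copies of \<open>\<alpha>\<close>. Since \<open>n\<close> is quantified inside the definition of the isotypic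
  component, an \<open>n\<close>-tuple is a sequence of vectors vanishing from index \<open>n\<close> on.
\<close>

definition tuples :: "nat \<Rightarrow> (nat \<Rightarrow> complex ^ 'n) set" where
  "tuples n = {v. \<forall>i\<ge>n. v i = 0}"

definition tuple_scale :: "complex \<Rightarrow> (nat \<Rightarrow> complex ^ 'n) \<Rightarrow> nat \<Rightarrow> complex ^ 'n" where
  "tuple_scale c v = (\<lambda>i. c *s v i)"

definition tuple_action ::
    "('g \<Rightarrow> complex ^ 'n ^ 'n) \<Rightarrow> 'g \<Rightarrow> (nat \<Rightarrow> complex ^ 'n) \<Rightarrow> nat \<Rightarrow> complex ^ 'n" where
  "tuple_action \<alpha> s v = (\<lambda>i. \<alpha> s *v v i)"


text \<open>Sums and products of functions are the pointwise ones of \<^theory>\<open>HOL-Library.Function_Algebras\<close>.\<close>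

definition fun_scale :: "complex \<Rightarrow> ('x \<Rightarrow> complex) \<Rightarrow> 'x \<Rightarrow> complex" where
  "fun_scale c f = (\<lambda>x. c * f x)"

global_interpretation cfun: vector_space fun_scale
  by unfold_locales (auto simp: fun_scale_def fun_eq_iff algebra_simps)

definition continuous_functions :: "('x::topological_space \<Rightarrow> complex) set" where
  "continuous_functions = {f. continuous_on UNIV f}"

definition translate ::
    "('g::uminus \<Rightarrow> 'x \<Rightarrow> 'x) \<Rightarrow> 'g \<Rightarrow> ('x \<Rightarrow> complex) \<Rightarrow> 'x \<Rightarrow> complex" where
  "translate act s f = (\<lambda>x. f (act (- s) x))"

definition invariant_functions ::
    "('g::uminus \<Rightarrow> 'x::topological_space \<Rightarrow> 'x) \<Rightarrow> ('x \<Rightarrow> complex) set" where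
  "invariant_functions act = {f \<in> continuous_functions. \<forall>s. translate act s f = f}"

definition isotypic_component ::
    "('g::uminus \<Rightarrow> 'x::topological_space \<Rightarrow> 'x) \<Rightarrow> ('g \<Rightarrow> complex ^ 'n ^ 'n) \<Rightarrow>
     ('x \<Rightarrow> complex) set" where
  "isotypic_component act \<alpha> =
     {f \<in> continuous_functions.
        \<exists>n. rep_isomorphic fun_scale (cfun.span (range (\<lambda>s. translate act s f))) (translate act)
              tuple_scale (tuples n) (tuple_action \<alpha>)}"

text \<open>
  Finite generation of \<open>M\<close> as a module over \<open>A\<close>, for a ring \<open>A\<close> of functions and an
  \<open>A\<close>-submodule \<open>M\<close> of the functions.
\<close>

definition finitely_generated_over ::
    "('x \<Rightarrow> complex) set \<Rightarrow> ('x \<Rightarrow> complex) set \<Rightarrow> bool" where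
  "finitely_generated_over A M \<longleftrightarrow>
     (\<exists>F. finite F \<and> F \<subseteq> M \<and>
          (\<forall>f\<in>M. \<exists>a. (\<forall>g\<in>F. a g \<in> A) \<and> f = (\<Sum>g\<in>F. a g * g)))"

end

theory Submission
  imports Defs
begin

text \<open>
  Fix \<open>h\<close> in the isotropy group of \<open>x\<close> and a matrix entry \<open>(i, j)\<close> at which \<open>\<alpha> h\<close> differs from the
  identity. The functional \<open>f \<mapsto> f (- h \<triangleright> y) - f y\<close> is linear over the invariant functions, and for each
  fixed \<open>f\<close> it tends to 0 as \<open>y \<rightarrow> x\<close>. If finitely many generators sufficed, the functionals at \<open>y\<close> would
  therefore be bounded, up to a constant depending on \<open>f\<close> only, by a quantity \<open>G y\<close> that tends to 0.
  At a free point \<open>y\<close>, however, averaging \<open>s \<mapsto> \<psi> (s \<triangleright> y) \<alpha> s\<close> for a bump function \<open>\<psi>\<close> at \<open>y\<close> and normalising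
  by an invariant function gives a member of the isotypic component, bounded independently of \<open>y\<close>,
  on which the functional is bounded away from 0. A gliding hump along free points \<open>y\<^sub>n\<close> with \<open>G y\<^sub>n\<close>
  rapidly decreasing contradicts the bound.
\<close>

section \<open>The invariant mean of a compact group\<close>

definition left_average :: "'g list \<Rightarrow> ('g::plus \<Rightarrow> real) \<Rightarrow> 'g \<Rightarrow> real" where
  "left_average xs f s = (\<Sum>x\<leftarrow>xs. f (x + s)) / real (length xs)"

definition right_average :: "'g list \<Rightarrow> ('g::plus \<Rightarrow> real) \<Rightarrow> 'g \<Rightarrow> real" where
  "right_average xs f s = (\<Sum>x\<leftarrow>xs. f (s + x)) / real (length xs)"

lemma real_eqI_epsilon:
  fixes a b :: real
  assumes "\<And>d. d > 0 \<Longrightarrow> \<bar>a - b\<bar> \<le> d"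
  shows "a = b"
proof (rule ccontr)
  assume "a \<noteq> b"
  with assms[of "\<bar>a - b\<bar> / 2"] show False by simp
qed

lemma left_average_lower:
  assumes "xs \<noteq> []" "\<And>s. a \<le> f s"
  shows "a \<le> left_average xs f s"
  using sum_list_mono[of xs "\<lambda>_. a" "\<lambda>x. f (x + s)"] assms
  by (auto simp: left_average_def field_simps sum_list_triv)

lemma left_average_upper:
  assumes "xs \<noteq> []" "\<And>s. f s \<le> b"
  shows "left_average xs f s \<le> b"
  using sum_list_mono[of xs "\<lambda>x. f (x + s)" "\<lambda>_. b"] assms
  by (auto simp: left_average_def field_simps sum_list_triv)

lemma right_average_lower:
  assumes "xs \<noteq> []" "\<And>s. a \<le> f s"
  shows "a \<le> right_average xs f s"
  using sum_list_mono[of xs "\<lambda>_. a" "\<lambda>x. f (s + x)"] assms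
  by (auto simp: right_average_def field_simps sum_list_triv)

lemma right_average_upper:
  assumes "xs \<noteq> []" "\<And>s. f s \<le> b"
  shows "right_average xs f s \<le> b"
  using sum_list_mono[of xs "\<lambda>x. f (s + x)" "\<lambda>_. b"] assms
  by (auto simp: right_average_def field_simps sum_list_triv)

lemma left_average_approx:
  assumes "xs \<noteq> []" "\<And>s. \<bar>f s - c\<bar> \<le> e"
  shows "\<bar>left_average xs f s - c\<bar> \<le> e"
  using left_average_lower[of xs "c - e" f s] left_average_upper[of xs f "c + e" s] assms
  by (force simp: abs_le_iff algebra_simps)

lemma right_average_approx:
  assumes "xs \<noteq> []" "\<And>s. \<bar>f s - c\<bar> \<le> e"
  shows "\<bar>right_average xs f s - c\<bar> \<le> e"
  using right_average_lower[of xs "c - e" f s] right_average_upper[of xs f "c + e" s] assms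
  by (force simp: abs_le_iff algebra_simps)

lemma left_average_add: "left_average xs (\<lambda>s. f s + g s) = (\<lambda>s. left_average xs f s + left_average xs g s)"
  by (simp add: left_average_def fun_eq_iff sum_list_addf add_divide_distrib)

lemma left_average_cmult: "left_average xs (\<lambda>s. c * f s) = (\<lambda>s. c * left_average xs f s)"
  by (simp add: left_average_def fun_eq_iff sum_list_const_mult)

text \<open>Left and right translations commute by associativity. This exchange is what later forces
  left and right averages to approach the same constant.\<close>

lemma left_right_average_commute:
  fixes f :: "'g::semigroup_add \<Rightarrow> real"
  shows "left_average xs (right_average ys f) = right_average ys (left_average xs f)"
proof -
  have "(\<Sum>x\<leftarrow>xs. \<Sum>y\<leftarrow>ys. f (x + s + y)) = (\<Sum>y\<leftarrow>ys. \<Sum>x\<leftarrow>xs. f (x + s + y))" for s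
    by (induction xs) (simp_all add: sum_list_addf)
  moreover have "(\<Sum>x\<leftarrow>xs. F x / c) = (\<Sum>x\<leftarrow>xs. F x) / c" for F :: "'g \<Rightarrow> real" and c xs
    by (induction xs) (simp_all add: add_divide_distrib)
  ultimately show ?thesis
    by (simp add: left_average_def right_average_def fun_eq_iff add.assoc mult.commute)
qed

text \<open>The single list consists of all sums \<open>x + y\<close>. It is chosen before
  \<open>f\<close>, so one list can serve two functions at once, as additivity of the mean
  requires.\<close>

lemma left_average_compose:
  fixes xs ys :: "'g::semigroup_add list"
  assumes "xs \<noteq> []" "ys \<noteq> []"
  shows "\<exists>zs. zs \<noteq> [] \<and> (\<forall>f :: 'g \<Rightarrow> real. left_average ys (left_average xs f) = left_average zs f)"
proof (intro exI conjI allI)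
  let ?zs = "concat (map (\<lambda>y. map (\<lambda>x. x + y) xs) ys)"
  have len: "length ?zs = length ys * length xs"
    by (induction ys) auto
  show "?zs \<noteq> []" using assms by (metis len length_0_conv mult_is_0)
  have eq: "(\<Sum>z\<leftarrow>?zs. f (z + s)) = (\<Sum>y\<leftarrow>ys. \<Sum>x\<leftarrow>xs. f (x + (y + s)))" for f :: "'g \<Rightarrow> real" and s
    by (induction ys) (simp_all add: o_def add.assoc)
  have "(\<Sum>x\<leftarrow>ys. F x / c) = (\<Sum>x\<leftarrow>ys. F x) / c" for F :: "'g \<Rightarrow> real" and c
    by (induction ys) (simp_all add: add_divide_distrib)
  then show "left_average ys (left_average xs f) = left_average ?zs f" for f
    unfolding left_average_def fun_eq_iff eq len by simp
qed

text \<open>Inversion exchanges the two sides, so oscillation estimates for right averages follow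
  from those for left averages.\<close>

lemma right_average_reflect:
  fixes f :: "'g::group_add \<Rightarrow> real"
  shows "right_average (map uminus xs) f s = left_average xs (\<lambda>t. f (- t)) (- s)"
  by (simp add: left_average_def right_average_def o_def minus_add)

lemma continuous_on_left_average:
  fixes f :: "'g::topological_group_add \<Rightarrow> real"
  assumes "continuous_on UNIV f"
  shows "continuous_on UNIV (left_average xs f)"
proof -
  have "continuous_on UNIV (\<lambda>s. \<Sum>x\<leftarrow>xs. f (x + s))"
    by (induction xs)
       (auto intro!: continuous_intros continuous_on_compose2[OF assms])
  then show ?thesis
    unfolding left_average_def[abs_def] by (cases "xs = []") (auto intro!: continuous_intros)
qed

section \<open>Compactness and nearly constant averages\<close>

text \<open>Uniform continuity via the tube lemma: the difference is jointly continuous in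
  \<open>(u, t)\<close> and vanishes on the compact slice \<open>u = 0\<close>.\<close>

lemma uniformly_close_right_translates:
  fixes f :: "'g::topological_group_add \<Rightarrow> real"
  assumes "compact (UNIV :: 'g set)" "continuous_on UNIV f" "0 < e"
  shows "\<exists>U. open U \<and> 0 \<in> U \<and> (\<forall>t. \<forall>u\<in>U. \<bar>f (t + u) - f t\<bar> \<le> e)"
proof -
  let ?W = "{p. \<bar>f (snd p + fst p) - f (snd p)\<bar> < e}"
  have W: "open ?W"
    by (intro open_Collect_less continuous_intros continuous_on_compose2[OF assms(2)]) auto
  have "{0} \<times> UNIV \<subseteq> ?W" using assms(3) by auto
  then obtain U where "0 \<in> U" "open U" "U \<times> UNIV \<subseteq> ?W"
    using Elementary_Topology.tube_lemma[OF assms(1) W] by blast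
  moreover have "\<bar>f (t + u) - f t\<bar> \<le> e" if "u \<in> U" for t u
  proof -
    have "(u, t) \<in> ?W" using \<open>U \<times> UNIV \<subseteq> ?W\<close> that by blast
    then show ?thesis by simp
  qed
  ultimately show ?thesis by blast
qed

lemma group_finite_translate_cover:
  fixes U :: "'g::topological_group_add set"
  assumes "compact (UNIV :: 'g set)" "open U" "0 \<in> U"
  shows "\<exists>qs. qs \<noteq> [] \<and> (\<forall>s. \<exists>q \<in> set qs. - q + s \<in> U)"
proof -
  have "open {s. - q + s \<in> U}" for q
    using open_vimage[OF assms(2), of "\<lambda>s. - q + s"]
      continuous_on_add[OF continuous_on_const continuous_on_id, of UNIV "- q"]
    by (simp add: vimage_def)
  moreover have "UNIV \<subseteq> (\<Union>q \<in> UNIV. {s. - q + s \<in> U})"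
    using assms(3) left_minus by (metis (mono_tags, lifting) UNIV_I UN_iff mem_Collect_eq subsetI)
  ultimately obtain Q where Q: "finite Q" "UNIV \<subseteq> (\<Union>q \<in> Q. {s. - q + s \<in> U})"
    using compactE_image[OF assms(1), of UNIV "\<lambda>q. {s. - q + s \<in> U}"] by metis
  obtain qs where "set qs = Q" using Q(1) finite_list by blast
  with Q(2) have cover: "\<exists>q \<in> set qs. - q + s \<in> U" for s by blast
  then have "qs \<noteq> []" by fastforce
  with cover show ?thesis by blast
qed

text \<open>
  If an average drops below its upper bound somewhere, it does so on a translate of a fixed
  neighbourhood of 0, and averaging over a finite cover by such translates lowers the upper bound
  by an amount that does not depend on the average.
\<close>

lemma left_average_small_oscillation:
  fixes f :: "'g::topological_group_add \<Rightarrow> real"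
  assumes K: "compact (UNIV :: 'g set)" and f: "continuous_on UNIV f" and e: "0 < e"
  shows "\<exists>xs c. xs \<noteq> [] \<and> (\<forall>s. \<bar>left_average xs f s - c\<bar> \<le> e)"
proof -
  define small where "small D \<longleftrightarrow> (\<exists>xs a. xs \<noteq> [] \<and> (\<forall>s. a \<le> left_average xs f s \<and> left_average xs f s \<le> a + D))" for D
  obtain U where U: "open U" "0 \<in> U" "\<And>t u. u \<in> U \<Longrightarrow> \<bar>f (t + u) - f t\<bar> \<le> e"
    using uniformly_close_right_translates[OF K f e] by blast
  obtain qs where qs: "qs \<noteq> []" "\<And>s. \<exists>q \<in> set qs. - q + s \<in> U"
    using group_finite_translate_cover[OF K U(1,2)] by blast
  define N where "N = real (length qs)"
  have N: "N > 0" using qs(1) by (simp add: N_def)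
  have step: "small (D - e / N)" if D: "small D" and not: "\<not> small (2 * e)" for D
  proof -
    obtain xs a where xs: "xs \<noteq> []" "\<And>s. a \<le> left_average xs f s" "\<And>s. left_average xs f s \<le> a + D"
      using D by (auto simp: small_def)
    define g where "g = left_average xs f"
    \<comment> \<open>Otherwise \<open>xs\<close> itself would witness \<open>small (2 * e)\<close>.
      Hence \<open>g\<close> dips below \<open>a + D - 2 * e\<close> at some \<open>s0\<close>, and
      stays below \<open>a + D - e\<close> on \<open>s0 + U\<close>.\<close>
    have "\<not> (\<forall>s. a + D - 2 * e \<le> g s \<and> g s \<le> (a + D - 2 * e) + 2 * e)"
      using not xs(1) unfolding small_def g_def by blast
    then obtain s0 where s0: "g s0 < a + D - 2 * e"
      using xs(3) by (auto simp: g_def not_le)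
    have near: "g (s0 + u) \<le> g s0 + e" if "u \<in> U" for u
    proof -
      have "(\<Sum>x\<leftarrow>xs. f (x + (s0 + u))) \<le> (\<Sum>x\<leftarrow>xs. f (x + s0) + e)"
        using U(3)[OF that] by (intro sum_list_mono) (metis abs_le_iff add.assoc diff_le_eq add.commute)
      then show ?thesis
        using xs(1) by (simp add: g_def left_average_def sum_list_addf sum_list_triv field_simps)
    qed
    \<comment> \<open>For every \<open>s\<close> some \<open>s0 - q + s\<close> lies in
      \<open>s0 + U\<close>. That term is at most \<open>a + D - e\<close> and the others at most
      \<open>a + D\<close>, so the average of \<open>N\<close> terms gains
      \<open>e / N\<close>.\<close>
    define ps where "ps = map (\<lambda>q. s0 - q) qs"
    have ps: "ps \<noteq> []" "real (length ps) = N" using qs(1) by (auto simp: ps_def N_def)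
    have upper: "left_average ps g s \<le> a + (D - e / N)" for s
    proof -
      obtain q where q: "q \<in> set qs" "- q + s \<in> U" using qs(2) by blast
      obtain us vs where uv: "qs = us @ q # vs" using q(1) by (meson split_list)
      have "g ((s0 - q) + s) \<le> a + D - e"
        using near[OF q(2)] s0 by (simp add: add.assoc[symmetric])
      moreover have "(\<Sum>x\<leftarrow>us. g (s0 - x + s)) \<le> (\<Sum>x\<leftarrow>us. a + D)"
        using xs(3) by (intro sum_list_mono) (auto simp: g_def)
      moreover have "(\<Sum>x\<leftarrow>vs. g (s0 - x + s)) \<le> (\<Sum>x\<leftarrow>vs. a + D)"
        using xs(3) by (intro sum_list_mono) (auto simp: g_def)
      ultimately have "(\<Sum>x\<leftarrow>ps. g (x + s)) \<le> N * (a + D) - e"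
        unfolding ps_def N_def uv by (simp add: o_def sum_list_triv algebra_simps)
      then have "left_average ps g s \<le> (N * (a + D) - e) / N"
        unfolding left_average_def ps(2) using N by (intro divide_right_mono) auto
      then show ?thesis using N by (simp add: field_simps)
    qed
    have "a \<le> left_average ps g s" for s
      using left_average_lower[OF ps(1)] xs(2) by (simp add: g_def)
    moreover obtain zs where "zs \<noteq> []" "left_average ps g = left_average zs f"
      using left_average_compose[OF xs(1) ps(1)] unfolding g_def by blast
    ultimately show ?thesis using upper unfolding small_def by metis
  qed
  have "small (2 * e)"
  proof (rule ccontr)
    assume not: "\<not> small (2 * e)"
    have "bounded (range f)"
      using compact_imp_bounded[OF compact_continuous_image[OF f K]] .
    then obtain B where B: "\<And>s. \<bar>f s\<bar> \<le> B" by (auto simp: bounded_iff)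
    \<comment> \<open>Averaging over \<open>[0]\<close> returns \<open>f\<close>, so the iteration
      starts from the oscillation bound \<open>2 * B\<close>.\<close>
    have "\<forall>s. - B \<le> left_average [0] f s \<and> left_average [0] f s \<le> - B + 2 * B"
      using B by (auto simp: left_average_def abs_le_iff minus_le_iff)
    then have "small (2 * B)"
      unfolding small_def by blast
    then have iter: "small (2 * B - real k * (e / N))" for k
    proof (induction k)
      case (Suc k)
      then show ?case using step[OF Suc.IH not] by (simp add: algebra_simps add_divide_distrib)
    qed simp
    \<comment> \<open>After enough steps the permitted oscillation is negative, which is absurd at
      any point.\<close>
    obtain k where "2 * B < real k * (e / N)"
      using reals_Archimedean3[of "e / N"] e N by auto
    moreover obtain xs a where "a \<le> left_average xs f 0" "left_average xs f 0 \<le> a + (2 * B - real k * (e / N))"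
      using iter[of k] unfolding small_def by blast
    ultimately show False by linarith
  qed
  then obtain xs a where xs: "xs \<noteq> []" "\<And>s. a \<le> left_average xs f s \<and> left_average xs f s \<le> a + 2 * e"
    unfolding small_def by blast
  have "\<bar>left_average xs f s - (a + e)\<bar> \<le> e" for s
    using xs(2)[of s] by linarith
  with xs(1) show ?thesis by (intro exI[of _ xs] exI[of _ "a + e"]) simp
qed

lemma right_average_small_oscillation:
  fixes f :: "'g::topological_group_add \<Rightarrow> real"
  assumes K: "compact (UNIV :: 'g set)" and f: "continuous_on UNIV f" and e: "0 < e"
  shows "\<exists>xs c. xs \<noteq> [] \<and> (\<forall>s. \<bar>right_average xs f s - c\<bar> \<le> e)"
proof -
  have g: "continuous_on UNIV (\<lambda>t. f (- t))"
    by (intro continuous_on_compose2[OF f] continuous_on_minus continuous_on_id) auto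
  obtain xs c where xs: "xs \<noteq> []" "\<And>s. \<bar>left_average xs (\<lambda>t. f (- t)) s - c\<bar> \<le> e"
    using left_average_small_oscillation[OF K g e] by blast
  have "\<bar>right_average (map uminus xs) f s - c\<bar> \<le> e" for s
    unfolding right_average_reflect by (rule xs(2))
  with xs(1) show ?thesis by (intro exI[of _ "map uminus xs"] exI[of _ c]) simp
qed

text \<open>
  Left and right averages commute, so the constants they approach agree; hence the supremum of the
  lower bounds of left averages is the common limit of both. Stated with left averages it is
  evidently invariant under right translations.
\<close>

definition haar_mean :: "('g::plus \<Rightarrow> real) \<Rightarrow> real" where
  "haar_mean f = Sup {b. \<exists>xs. xs \<noteq> [] \<and> (\<forall>s. b \<le> left_average xs f s)}"

text \<open>Apply both averages. Read in one order the result is near \<open>c'\<close>, in the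
  other near \<open>c\<close>, and the two readings agree.\<close>

lemma left_right_close:
  fixes f :: "'g::semigroup_add \<Rightarrow> real"
  assumes "xs \<noteq> []" "\<And>s. \<bar>left_average xs f s - c\<bar> \<le> e"
    and "ys \<noteq> []" "\<And>s. \<bar>right_average ys f s - c'\<bar> \<le> e'"
  shows "\<bar>c - c'\<bar> \<le> e + e'"
proof -
  have "\<bar>left_average xs (right_average ys f) undefined - c'\<bar> \<le> e'"
    by (rule left_average_approx) (use assms in auto)
  moreover have "\<bar>right_average ys (left_average xs f) undefined - c\<bar> \<le> e"
    by (rule right_average_approx) (use assms in auto)
  ultimately show ?thesis by (simp add: left_right_average_commute)
qed

text \<open>One right average pins the supremum from both sides: a lower bound of a left average
  survives right averaging, hence is at most \<open>c + e\<close>, while nearly constant left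
  averages supply lower bounds arbitrarily close to \<open>c - e\<close>.\<close>

lemma right_average_near_haar_mean:
  fixes f :: "'g::topological_group_add \<Rightarrow> real"
  assumes K: "compact (UNIV :: 'g set)" and f: "continuous_on UNIV f"
    and ys: "ys \<noteq> []" "\<And>s. \<bar>right_average ys f s - c\<bar> \<le> e"
  shows "\<bar>haar_mean f - c\<bar> \<le> e"
proof -
  let ?S = "{b. \<exists>xs. xs \<noteq> [] \<and> (\<forall>s. b \<le> left_average xs f s)}"
  have ub: "b \<le> c + e" if "b \<in> ?S" for b
  proof -
    from that obtain xs where xs: "xs \<noteq> []" "\<And>s. b \<le> left_average xs f s" by blast
    have "b \<le> right_average ys (left_average xs f) undefined"
      using right_average_lower[OF ys(1)] xs(2) by blast
    also have "\<dots> = left_average xs (right_average ys f) undefined"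
      by (simp add: left_right_average_commute)
    also have "\<dots> \<le> c + e"
      using ys(2) by (intro left_average_upper[OF xs(1)]) (metis abs_le_iff diff_le_eq add.commute)
    finally show ?thesis .
  qed
  have lb: "c - e - d \<le> haar_mean f" if "d > 0" for d
  proof -
    have d: "d / 2 > 0" using that by simp
    obtain xs k where xs: "xs \<noteq> []" "\<And>s. \<bar>left_average xs f s - k\<bar> \<le> d / 2"
      using left_average_small_oscillation[OF K f d] by blast
    have "\<bar>k - c\<bar> \<le> d / 2 + e" using left_right_close[OF xs ys] .
    moreover have "k - d / 2 \<in> ?S" using xs by (smt (verit) mem_Collect_eq)
    then have "k - d / 2 \<le> haar_mean f"
      unfolding haar_mean_def using ub by (intro cSup_upper bdd_aboveI[of _ "c + e"]) auto
    ultimately show ?thesis by (simp add: abs_le_iff)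
  qed
  have ne: "?S \<noteq> {}"
  proof -
    obtain xs k where xs: "xs \<noteq> []" "\<And>s. \<bar>left_average xs f s - k\<bar> \<le> 1"
      using left_average_small_oscillation[OF K f zero_less_one] by blast
    then have "k - 1 \<in> ?S" by (smt (verit) mem_Collect_eq)
    then show ?thesis by blast
  qed
  have "haar_mean f \<le> c + e"
    unfolding haar_mean_def using ub ne by (intro cSup_least) auto
  moreover have "c - e \<le> haar_mean f"
  proof (rule field_le_epsilon)
    show "c - e \<le> haar_mean f + d" if "d > 0" for d using lb[OF that] by linarith
  qed
  ultimately show ?thesis by (simp add: abs_le_iff)
qed

lemma right_average_approximates_haar_mean:
  fixes f :: "'g::topological_group_add \<Rightarrow> real"
  assumes K: "compact (UNIV :: 'g set)" and f: "continuous_on UNIV f" and e: "0 < e"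
  shows "\<exists>ys. ys \<noteq> [] \<and> (\<forall>s. \<bar>right_average ys f s - haar_mean f\<bar> \<le> e)"
proof -
  have e2: "e / 2 > 0" using e by simp
  obtain ys c where ys: "ys \<noteq> []" "\<And>s. \<bar>right_average ys f s - c\<bar> \<le> e / 2"
    using right_average_small_oscillation[OF K f e2] by blast
  have "\<bar>haar_mean f - c\<bar> \<le> e / 2" by (rule right_average_near_haar_mean[OF K f ys])
  then have "\<bar>right_average ys f s - haar_mean f\<bar> \<le> e" for s
    using ys(2)[of s] by linarith
  then show ?thesis using ys(1) by (intro exI[of _ ys]) simp
qed

text \<open>The supremum has been located through right averages, so a left average is compared with
  a right average already close to \<open>haar_mean f\<close>.\<close>

lemma left_average_near_haar_mean:
  fixes f :: "'g::topological_group_add \<Rightarrow> real"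
  assumes K: "compact (UNIV :: 'g set)" and f: "continuous_on UNIV f"
    and xs: "xs \<noteq> []" "\<And>s. \<bar>left_average xs f s - c\<bar> \<le> e"
  shows "\<bar>haar_mean f - c\<bar> \<le> e"
proof (rule field_le_epsilon)
  fix d :: real assume "d > 0"
  then obtain ys where "ys \<noteq> []" "\<And>s. \<bar>right_average ys f s - haar_mean f\<bar> \<le> d"
    using right_average_approximates_haar_mean[OF K f] by blast
  with left_right_close[OF xs] have "\<bar>c - haar_mean f\<bar> \<le> e + d" by blast
  then show "\<bar>haar_mean f - c\<bar> \<le> e + d" by simp
qed

lemma left_average_approximates_haar_mean:
  fixes f :: "'g::topological_group_add \<Rightarrow> real"
  assumes K: "compact (UNIV :: 'g set)" and f: "continuous_on UNIV f" and e: "0 < e"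
  shows "\<exists>ys. ys \<noteq> [] \<and> (\<forall>s. \<bar>left_average ys f s - haar_mean f\<bar> \<le> e)"
proof -
  have e2: "e / 2 > 0" using e by simp
  obtain ys c where ys: "ys \<noteq> []" "\<And>s. \<bar>left_average ys f s - c\<bar> \<le> e / 2"
    using left_average_small_oscillation[OF K f e2] by blast
  have "\<bar>haar_mean f - c\<bar> \<le> e / 2" by (rule left_average_near_haar_mean[OF K f ys])
  then have "\<bar>left_average ys f s - haar_mean f\<bar> \<le> e" for s
    using ys(2)[of s] by linarith
  then show ?thesis using ys(1) by (intro exI[of _ ys]) simp
qed

section \<open>Invariance, linearity, positivity and continuity of the mean\<close>

lemma haar_mean_right_invariant:
  fixes f :: "'g::group_add \<Rightarrow> real"
  shows "haar_mean (\<lambda>s. f (s + t)) = haar_mean f"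
proof -
  have "left_average xs (\<lambda>s. f (s + t)) s = left_average xs f (s + t)" for xs s
    by (simp add: left_average_def add.assoc)
  then have "(\<forall>s. b \<le> left_average xs (\<lambda>s. f (s + t)) s) \<longleftrightarrow> (\<forall>s. b \<le> left_average xs f s)" for b xs
    by (metis diff_add_cancel)
  then show ?thesis by (simp add: haar_mean_def)
qed

text \<open>A right average of \<open>f\<close> close to the mean stays close after left averaging,
  because the two commute. For one-element lists this is left invariance.\<close>

lemma haar_mean_left_average:
  fixes f :: "'g::topological_group_add \<Rightarrow> real"
  assumes K: "compact (UNIV :: 'g set)" and f: "continuous_on UNIV f" and xs: "xs \<noteq> []"
  shows "haar_mean (left_average xs f) = haar_mean f"
proof -
  have "\<bar>haar_mean (left_average xs f) - haar_mean f\<bar> \<le> d" if d: "d > 0" for d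
  proof -
    obtain ys where ys: "ys \<noteq> []" "\<And>s. \<bar>right_average ys f s - haar_mean f\<bar> \<le> d"
      using right_average_approximates_haar_mean[OF K f d] by blast
    show ?thesis
    proof (rule right_average_near_haar_mean[OF K continuous_on_left_average[OF f] ys(1)])
      show "\<bar>right_average ys (left_average xs f) s - haar_mean f\<bar> \<le> d" for s
        using left_average_approx[where f = "right_average ys f", OF xs ys(2)] by (simp add: left_right_average_commute)
    qed
  qed
  then show ?thesis by (rule real_eqI_epsilon)
qed

lemma haar_mean_add:
  fixes f g :: "'g::topological_group_add \<Rightarrow> real"
  assumes K: "compact (UNIV :: 'g set)" and f: "continuous_on UNIV f" and g: "continuous_on UNIV g"
  shows "haar_mean (\<lambda>s. f s + g s) = haar_mean f + haar_mean g"
proof -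
  have "\<bar>haar_mean (\<lambda>s. f s + g s) - (haar_mean f + haar_mean g)\<bar> \<le> d" if d: "d > 0" for d
  proof -
    have d2: "d / 2 > 0" using d by simp
    obtain xs where xs: "xs \<noteq> []" "\<And>s. \<bar>left_average xs f s - haar_mean f\<bar> \<le> d / 2"
      using left_average_approximates_haar_mean[OF K f d2] by blast
    \<comment> \<open>The second list flattens the already averaged \<open>g\<close>, whose mean is
      unchanged; averaging once more does not spoil the estimate for \<open>f\<close>. The composite
      list \<open>zs\<close> is therefore good for both.\<close>
    obtain ys where ys: "ys \<noteq> []" "\<And>s. \<bar>left_average ys (left_average xs g) s - haar_mean g\<bar> \<le> d / 2"
      using left_average_approximates_haar_mean[OF K continuous_on_left_average[OF g, of xs] d2]
      unfolding haar_mean_left_average[OF K g xs(1)] by blast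
    obtain zs where zs: "zs \<noteq> []" "\<And>f :: 'g \<Rightarrow> real. left_average ys (left_average xs f) = left_average zs f"
      using left_average_compose[OF xs(1) ys(1)] by blast
    have zf: "\<bar>left_average zs f s - haar_mean f\<bar> \<le> d / 2" for s
      unfolding zs(2)[symmetric] by (rule left_average_approx[OF ys(1) xs(2)])
    have zg: "\<bar>left_average zs g s - haar_mean g\<bar> \<le> d / 2" for s
      unfolding zs(2)[symmetric] by (rule ys(2))
    have "\<bar>left_average zs (\<lambda>s. f s + g s) s - (haar_mean f + haar_mean g)\<bar> \<le> d" for s
      using zf[of s] zg[of s] unfolding left_average_add by linarith
    then show ?thesis
      by (intro left_average_near_haar_mean[OF K _ zs(1)]) (auto intro!: continuous_intros f g)
  qed
  then show ?thesis by (rule real_eqI_epsilon)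
qed

lemma haar_mean_cmult:
  fixes f :: "'g::topological_group_add \<Rightarrow> real"
  assumes K: "compact (UNIV :: 'g set)" and f: "continuous_on UNIV f"
  shows "haar_mean (\<lambda>s. c * f s) = c * haar_mean f"
proof -
  have "\<bar>haar_mean (\<lambda>s. c * f s) - c * haar_mean f\<bar> \<le> d" if d: "d > 0" for d
  proof -
    \<comment> \<open>The added \<open>1\<close> covers the case \<open>c = 0\<close>.\<close>
    define d' where "d' = d / (\<bar>c\<bar> + 1)"
    have d': "d' > 0" "\<bar>c\<bar> * d' \<le> d" using d by (auto simp: d'_def field_simps)
    obtain xs where xs: "xs \<noteq> []" "\<And>s. \<bar>left_average xs f s - haar_mean f\<bar> \<le> d'"
      using left_average_approximates_haar_mean[OF K f d'(1)] by blast
    have "\<bar>left_average xs (\<lambda>s. c * f s) s - c * haar_mean f\<bar> \<le> d" for s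
    proof -
      have "\<bar>left_average xs (\<lambda>s. c * f s) s - c * haar_mean f\<bar> = \<bar>c\<bar> * \<bar>left_average xs f s - haar_mean f\<bar>"
        by (simp add: left_average_cmult abs_mult[symmetric] algebra_simps)
      also have "\<dots> \<le> \<bar>c\<bar> * d'" by (intro mult_left_mono xs(2)) auto
      finally show ?thesis using d'(2) by simp
    qed
    then show ?thesis
      by (intro left_average_near_haar_mean[OF K _ xs(1)]) (auto intro!: continuous_intros f)
  qed
  then show ?thesis by (rule real_eqI_epsilon)
qed

lemma haar_mean_diff:
  fixes f g :: "'g::topological_group_add \<Rightarrow> real"
  assumes K: "compact (UNIV :: 'g set)" and f: "continuous_on UNIV f" and g: "continuous_on UNIV g"
  shows "haar_mean (\<lambda>s. f s - g s) = haar_mean f - haar_mean g"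
proof -
  have "continuous_on UNIV (\<lambda>s. (-1) * g s)" by (intro continuous_intros g)
  then have "haar_mean (\<lambda>s. f s + (-1) * g s) = haar_mean f + (-1) * haar_mean g"
    by (simp only: haar_mean_add[OF K f] haar_mean_cmult[OF K g])
  then show ?thesis by simp
qed

lemma haar_mean_nonneg:
  fixes f :: "'g::topological_group_add \<Rightarrow> real"
  assumes K: "compact (UNIV :: 'g set)" and f: "continuous_on UNIV f" and nn: "\<And>s. 0 \<le> f s"
  shows "0 \<le> haar_mean f"
proof (rule field_le_epsilon)
  fix d :: real assume "d > 0"
  then obtain xs where xs: "xs \<noteq> []" "\<And>s. \<bar>left_average xs f s - haar_mean f\<bar> \<le> d"
    using left_average_approximates_haar_mean[OF K f] by blast
  have "0 \<le> left_average xs f 0" using left_average_lower[OF xs(1)] nn by blast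
  with xs(2)[of 0] show "0 \<le> haar_mean f + d" by linarith
qed

lemma haar_mean_mono:
  fixes f g :: "'g::topological_group_add \<Rightarrow> real"
  assumes K: "compact (UNIV :: 'g set)" and f: "continuous_on UNIV f" and g: "continuous_on UNIV g"
    and le: "\<And>s. f s \<le> g s"
  shows "haar_mean f \<le> haar_mean g"
proof -
  have "0 \<le> haar_mean (\<lambda>s. g s - f s)"
    using le by (intro haar_mean_nonneg[OF K]) (auto intro!: continuous_intros f g)
  then show ?thesis by (simp add: haar_mean_diff[OF K g f])
qed

lemma haar_mean_const:
  assumes "compact (UNIV :: 'g::topological_group_add set)"
  shows "haar_mean (\<lambda>s :: 'g. c) = c"
proof -
  have "\<bar>haar_mean (\<lambda>s :: 'g. c) - c\<bar> \<le> 0"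
    by (rule left_average_near_haar_mean[OF assms _, of _ "[0]"]) (auto simp: left_average_def)
  then show ?thesis by simp
qed

text \<open>Finitely many translates of the open set where \<open>f\<close> exceeds half of
  \<open>f 0\<close> cover the group, so some left average of \<open>f\<close> is bounded below by a
  positive constant, and left averaging preserves the mean.\<close>

lemma haar_mean_pos:
  fixes f :: "'g::topological_group_add \<Rightarrow> real"
  assumes K: "compact (UNIV :: 'g set)" and f: "continuous_on UNIV f" and nn: "\<And>s. 0 \<le> f s"
    and pos: "0 < f 0"
  shows "0 < haar_mean f"
proof -
  let ?d = "f 0 / 2"
  have "open {s. ?d < f s}"
    by (intro open_Collect_less continuous_intros f)
  moreover have "0 \<in> {s. ?d < f s}" using pos by simp
  ultimately obtain qs where qs: "qs \<noteq> []" "\<And>s. \<exists>q \<in> set qs. - q + s \<in> {s. ?d < f s}"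
    using group_finite_translate_cover[OF K] by blast
  define ps where "ps = map uminus qs"
  have ps: "ps \<noteq> []" using qs(1) by (simp add: ps_def)
  have "?d / real (length ps) \<le> left_average ps f s" for s
  proof -
    obtain q where q: "q \<in> set qs" "?d < f (- q + s)" using qs(2) by blast
    obtain us vs where "qs = us @ q # vs" using q(1) by (meson split_list)
    moreover have "0 \<le> (\<Sum>x\<leftarrow>us. f (- x + s))" "0 \<le> (\<Sum>x\<leftarrow>vs. f (- x + s))"
      using nn by (auto intro!: sum_list_nonneg)
    ultimately have "?d \<le> (\<Sum>x\<leftarrow>ps. f (x + s))"
      using q(2) by (simp add: ps_def o_def)
    then show ?thesis unfolding left_average_def
      by (intro divide_right_mono) auto
  qed
  then have "haar_mean (\<lambda>s :: 'g. ?d / real (length ps)) \<le> haar_mean (left_average ps f)"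
    by (intro haar_mean_mono[OF K] continuous_on_left_average f) (auto intro!: continuous_intros)
  then have "?d / real (length ps) \<le> haar_mean f"
    by (simp add: haar_mean_const[OF K] haar_mean_left_average[OF K f ps])
  moreover have "0 < ?d / real (length ps)" using pos ps by simp
  ultimately show ?thesis by linarith
qed

text \<open>The tube lemma makes \<open>F z\<close> close to \<open>F z0\<close> uniformly over the
  group for \<open>z\<close> near \<open>z0\<close>; monotonicity passes this to the means.\<close>

lemma continuous_on_haar_mean:
  fixes F :: "'x::topological_space \<Rightarrow> 'g::topological_group_add \<Rightarrow> real"
  assumes K: "compact (UNIV :: 'g set)" and F: "continuous_on UNIV (\<lambda>p. F (fst p) (snd p))"
  shows "continuous_on UNIV (\<lambda>z. haar_mean (F z))"
  unfolding continuous_on_def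
proof (intro ballI tendstoI)
  fix z0 :: 'x and e :: real assume e: "e > 0"
  have slice: "continuous_on UNIV (F z)" for z
  proof -
    have "continuous_on UNIV (\<lambda>s :: 'g. (z, s))" by (intro continuous_intros)
    from continuous_on_compose2[OF F this] show ?thesis by simp
  qed
  let ?W = "{p. \<bar>F (fst p) (snd p) - F z0 (snd p)\<bar> < e / 2}"
  have W: "open ?W"
    by (intro open_Collect_less continuous_intros F continuous_on_compose2[OF slice[of z0]]) auto
  have "{z0} \<times> UNIV \<subseteq> ?W" using e by auto
  then obtain U where U: "z0 \<in> U" "open U" "U \<times> UNIV \<subseteq> ?W"
    using Elementary_Topology.tube_lemma[OF K W] by blast
  have "dist (haar_mean (F z)) (haar_mean (F z0)) < e" if "z \<in> U" for z
  proof -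
    have close: "F z s \<le> F z0 s + e / 2" "F z0 s \<le> F z s + e / 2" for s
    proof -
      have "(z, s) \<in> ?W" using U(3) that by blast
      then have "\<bar>F z s - F z0 s\<bar> < e / 2" by simp
      then show "F z s \<le> F z0 s + e / 2" "F z0 s \<le> F z s + e / 2" by linarith+
    qed
    have "haar_mean (F z) \<le> haar_mean (\<lambda>s. F z0 s + e / 2)" "haar_mean (F z0) \<le> haar_mean (\<lambda>s. F z s + e / 2)"
      using close by (auto intro!: haar_mean_mono[OF K] continuous_intros slice)
    then show ?thesis using e
      by (simp add: haar_mean_add[OF K] slice haar_mean_const[OF K] dist_real_def abs_less_iff)
  qed
  then show "\<forall>\<^sub>F z in at z0 within UNIV. dist (haar_mean (F z)) (haar_mean (F z0)) < e"
    using U by (auto simp: eventually_at_topological)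
qed

section \<open>Complex-valued means\<close>

definition complex_haar_mean :: "('g::plus \<Rightarrow> complex) \<Rightarrow> complex" where
  "complex_haar_mean f = Complex (haar_mean (\<lambda>s. Re (f s))) (haar_mean (\<lambda>s. Im (f s)))"

lemma complex_haar_mean_right_invariant:
  fixes f :: "'g::group_add \<Rightarrow> complex"
  shows "complex_haar_mean (\<lambda>s. f (s + t)) = complex_haar_mean f"
  by (simp add: complex_haar_mean_def haar_mean_right_invariant[where f = "\<lambda>s. Re (f s)"]
      haar_mean_right_invariant[where f = "\<lambda>s. Im (f s)"])

lemma complex_haar_mean_add:
  fixes f g :: "'g::topological_group_add \<Rightarrow> complex"
  assumes K: "compact (UNIV :: 'g set)" and f: "continuous_on UNIV f" and g: "continuous_on UNIV g"
  shows "complex_haar_mean (\<lambda>s. f s + g s) = complex_haar_mean f + complex_haar_mean g"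
  using f g by (simp add: complex_haar_mean_def complex_eq_iff haar_mean_add[OF K] continuous_on_Re continuous_on_Im)

lemma complex_haar_mean_cmult:
  fixes f :: "'g::topological_group_add \<Rightarrow> complex"
  assumes K: "compact (UNIV :: 'g set)" and f: "continuous_on UNIV f"
  shows "complex_haar_mean (\<lambda>s. c * f s) = c * complex_haar_mean f"
  using f
  by (simp add: complex_haar_mean_def complex_eq_iff haar_mean_add[OF K] haar_mean_diff[OF K]
      haar_mean_cmult[OF K] continuous_on_Re continuous_on_Im continuous_on_mult_left)

lemma complex_haar_mean_of_real:
  assumes "compact (UNIV :: 'g::topological_group_add set)"
  shows "complex_haar_mean (\<lambda>s :: 'g. complex_of_real (f s)) = complex_of_real (haar_mean f)"
  by (simp add: complex_haar_mean_def complex_eq_iff haar_mean_const[OF assms])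

lemma complex_haar_mean_diff:
  fixes f g :: "'g::topological_group_add \<Rightarrow> complex"
  assumes K: "compact (UNIV :: 'g set)" and f: "continuous_on UNIV f" and g: "continuous_on UNIV g"
  shows "complex_haar_mean (\<lambda>s. f s - g s) = complex_haar_mean f - complex_haar_mean g"
  using f g by (simp add: complex_haar_mean_def complex_eq_iff haar_mean_diff[OF K] continuous_on_Re continuous_on_Im)

lemma complex_haar_mean_sum:
  fixes f :: "'i \<Rightarrow> 'g::topological_group_add \<Rightarrow> complex"
  assumes K: "compact (UNIV :: 'g set)" and "finite I" and f: "\<And>i. i \<in> I \<Longrightarrow> continuous_on UNIV (f i)"
  shows "complex_haar_mean (\<lambda>s. \<Sum>i\<in>I. f i s) = (\<Sum>i\<in>I. complex_haar_mean (f i))"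
  using assms(2) f
proof (induction I)
  case empty
  then show ?case using complex_haar_mean_of_real[OF K, of "\<lambda>_. 0"] haar_mean_const[OF K, of 0] by simp
next
  case (insert i I)
  then show ?case by (simp add: complex_haar_mean_add[OF K] continuous_on_sum)
qed

text \<open>The factor 2 comes from bounding real and imaginary parts separately; it reappears in
  the bound \<open>2 * C\<close> on equivariant rows.\<close>

lemma norm_complex_haar_mean_le:
  fixes f :: "'g::topological_group_add \<Rightarrow> complex"
  assumes K: "compact (UNIV :: 'g set)" and f: "continuous_on UNIV f" and g: "continuous_on UNIV g"
    and le: "\<And>s. norm (f s) \<le> g s"
  shows "norm (complex_haar_mean f) \<le> 2 * haar_mean g"
proof -
  have part: "\<bar>haar_mean p\<bar> \<le> haar_mean g" if p: "continuous_on UNIV p" "\<And>s. \<bar>p s\<bar> \<le> g s" for p :: "'g \<Rightarrow> real"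
  proof -
    have "p s \<le> g s" "(-1) * p s \<le> g s" for s using p(2)[of s] by linarith+
    then have "haar_mean p \<le> haar_mean g" "haar_mean (\<lambda>s. (-1) * p s) \<le> haar_mean g"
      by (intro haar_mean_mono[OF K] p(1) g continuous_on_mult_left; simp)+
    then show ?thesis by (simp only: haar_mean_cmult[OF K p(1)] abs_le_iff) simp
  qed
  have "\<bar>Re (f s)\<bar> \<le> g s" "\<bar>Im (f s)\<bar> \<le> g s" for s
    using le[of s] abs_Re_le_cmod[of "f s"] abs_Im_le_cmod[of "f s"] by linarith+
  then have "\<bar>Re (complex_haar_mean f)\<bar> \<le> haar_mean g" "\<bar>Im (complex_haar_mean f)\<bar> \<le> haar_mean g"
    unfolding complex_haar_mean_def complex.sel by (intro part continuous_on_Re continuous_on_Im f; simp)+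
  then show ?thesis using cmod_le[of "complex_haar_mean f"] by linarith
qed

lemma continuous_on_complex_haar_mean:
  fixes F :: "'x::topological_space \<Rightarrow> 'g::topological_group_add \<Rightarrow> complex"
  assumes K: "compact (UNIV :: 'g set)" and F: "continuous_on UNIV (\<lambda>p. F (fst p) (snd p))"
  shows "continuous_on UNIV (\<lambda>z. complex_haar_mean (F z))"
  unfolding complex_haar_mean_def
  by (intro continuous_on_Complex continuous_on_haar_mean[OF K] continuous_on_Re continuous_on_Im F)

section \<open>Equivariant families\<close>

text \<open>
  \<open>\<phi> z\<close> is a row vector, and the equation reads \<open>\<phi> (- s \<triangleright> z) = \<phi> z \<alpha> s\<close>. The functions
  \<open>z \<mapsto> \<Sum>\<^sub>k \<phi> z k * v $ k\<close> then transform under translation as the vectors \<open>v\<close> do under \<open>\<alpha>\<close>.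
\<close>

definition equivariant_rows ::
    "('g::uminus \<Rightarrow> 'x::topological_space \<Rightarrow> 'x) \<Rightarrow> ('g \<Rightarrow> complex ^ 'n ^ 'n) \<Rightarrow> ('x \<Rightarrow> 'n \<Rightarrow> complex) set" where
  "equivariant_rows act \<alpha> =
     {\<phi>. (\<forall>j. continuous_on UNIV (\<lambda>z. \<phi> z j)) \<and>
         (\<forall>s z j. \<phi> (act (- s) z) j = (\<Sum>k\<in>UNIV. \<phi> z k * \<alpha> s $ k $ j))}"

lemma continuous_on_action:
  assumes act: "continuous_action act" and f: "continuous_on S f" and g: "continuous_on S g"
  shows "continuous_on S (\<lambda>p. act (f p) (g p))"
  using continuous_on_compose2[of UNIV "\<lambda>(s, x). act s x" S "\<lambda>p. (f p, g p)"] act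
  by (auto simp: continuous_action_def intro!: continuous_on_Pair f g)

lemma representation_add_nth:
  assumes "representation \<alpha>"
  shows "\<alpha> (s + t) $ i $ j = (\<Sum>k\<in>UNIV. \<alpha> s $ i $ k * \<alpha> t $ k $ j)"
  using assms by (simp add: representation_def matrix_matrix_mult_def)

section \<open>Equivariant rows built from bump functions at free points\<close>

lemma compact_t2_bump:
  fixes y :: "'x::t2_space"
  assumes "compact (UNIV :: 'x set)" "closed S" "y \<notin> S"
  shows "\<exists>\<psi> :: 'x \<Rightarrow> real. continuous_on UNIV \<psi> \<and> (\<forall>z. 0 \<le> \<psi> z \<and> \<psi> z \<le> 1) \<and> \<psi> y = 1 \<and> (\<forall>z\<in>S. \<psi> z = 0)"
proof -
  have "Hausdorff_space (euclidean :: 'x topology)"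
    unfolding Hausdorff_space_def disjnt_def using hausdorff[where 'a = 'x]
    by (simp add: conj_ac)
  then have "normal_space (euclidean :: 'x topology)"
    using assms(1) by (intro compact_Hausdorff_or_regular_imp_normal_space) (auto simp: compact_space_def)
  then obtain \<psi> :: "'x \<Rightarrow> real"
    where "continuous_map euclidean (top_of_set {0..1}) \<psi>" "\<psi> ` S \<subseteq> {0}" "\<psi> ` {y} \<subseteq> {1}"
    using Urysohn_lemma[of euclidean S "{y}" 0 1] assms by (auto simp: disjnt_def)
  then show ?thesis
    by (intro exI[of _ \<psi>]) (auto simp: continuous_map_in_subtopology image_subset_iff)
qed

text \<open>If all the weight sat at the neutral element, the row at \<open>y\<close> would be row
  \<open>i\<close> of the identity and the row at \<open>act (- h) y\<close> would be row
  \<open>i\<close> of \<open>\<alpha> h\<close>, so entry \<open>j\<close> would jump by exactly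
  \<open>w\<close>. Freeness lets a bump at \<open>y\<close> approximate this situation.\<close>

lemma equivariant_row_oscillating_at_free_point:
  fixes act :: "'g::topological_group_add \<Rightarrow> 'x::t2_space \<Rightarrow> 'x"
    and \<alpha> :: "'g \<Rightarrow> complex ^ 'n ^ 'n" and i j :: 'n
  assumes K: "compact (UNIV :: 'g set)" and X: "compact (UNIV :: 'x set)"
    and act: "continuous_action act" and \<alpha>: "representation \<alpha>"
    and y: "y \<in> free_points act" and C: "\<And>s k. norm (\<alpha> s $ i $ k) \<le> C"
    and w: "w = \<alpha> h $ i $ j - mat 1 $ i $ j" "w \<noteq> 0"
  shows "\<exists>\<phi>\<in>equivariant_rows act \<alpha>. (\<forall>z k. norm (\<phi> z k) \<le> 2 * C) \<and>
           norm w / 2 \<le> norm (\<phi> (act (- h) y) j - \<phi> y j)"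
proof -
  have act_add: "act (s + t) z = act s (act t z)" and act_0: "act 0 z = z" for s t z
    using act by (auto simp: continuous_action_def)
  have cont_\<alpha>: "continuous_on UNIV (\<lambda>s. \<alpha> s $ k $ l)" for k l
    using \<alpha> by (auto simp: representation_def intro!: continuous_intros)
  have cont_\<alpha>h: "continuous_on UNIV (\<lambda>s. \<alpha> (s + t) $ k $ l)" for t k l
    by (rule continuous_on_compose2[OF cont_\<alpha>]) (auto intro!: continuous_on_add continuous_intros)
  have C0: "0 \<le> C" using C norm_ge_zero order_trans by blast
  define D where "D s = \<alpha> (s + h) $ i $ j - \<alpha> s $ i $ j" for s
  have cont_D: "continuous_on UNIV D"
    unfolding D_def by (intro continuous_intros cont_\<alpha> cont_\<alpha>h)
  \<comment> \<open>The tolerance is a quarter because the norm estimate for complex means doubles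
    it; half of \<open>norm w\<close> then remains.\<close>
  define W where "W = {s. norm (D s - w) < norm w / 4}"
  have "open W"
    unfolding W_def by (intro open_Collect_less continuous_intros cont_D)
  have "\<alpha> 0 = mat 1" using \<alpha> by (simp add: representation_def)
  then have "D 0 = w" by (simp add: D_def w)
  then have "0 \<in> W" using w(2) by (simp add: W_def)
  \<comment> \<open>The part of the orbit coming from outside \<open>W\<close> is closed by
    compactness and misses \<open>y\<close> by freeness, so a bump at \<open>y\<close> can vanish on
    it.\<close>
  have "compact (- W)"
    using K \<open>open W\<close> by (metis Compl_eq_Diff_UNIV compact_diff)
  then have "compact ((\<lambda>s. act s y) ` (- W))"
    by (intro compact_continuous_image continuous_on_action[OF act] continuous_intros)
  then have "closed ((\<lambda>s. act s y) ` (- W))" by (rule compact_imp_closed)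
  have "s = 0" if "act s y = y" for s
    using y that unfolding free_points_def isotropy_def by blast
  then have "y \<notin> (\<lambda>s. act s y) ` (- W)"
    using \<open>0 \<in> W\<close> by (metis ComplD imageE)
  with \<open>closed _\<close> obtain \<psi> :: "'x \<Rightarrow> real" where \<psi>: "continuous_on UNIV \<psi>" "\<And>z. 0 \<le> \<psi> z" "\<psi> y = 1"
    "\<And>s. s \<notin> W \<Longrightarrow> \<psi> (act s y) = 0"
    using compact_t2_bump[OF X, of "(\<lambda>s. act s y) ` (- W)" y] by blast
  have cont_\<psi>: "continuous_on UNIV (\<lambda>s. \<psi> (act s z))" for z
    by (intro continuous_on_compose2[OF \<psi>(1)] continuous_on_action[OF act] continuous_intros) auto
  define N where "N z = haar_mean (\<lambda>s. \<psi> (act s z))" for z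
  have N_nonneg: "0 \<le> N z" for z unfolding N_def by (intro haar_mean_nonneg[OF K] cont_\<psi> \<psi>(2))
  have N_pos: "0 < N y"
    unfolding N_def by (intro haar_mean_pos[OF K] cont_\<psi> \<psi>(2)) (simp add: act_0 \<psi>(3))
  have N_inv: "N (act t z) = N z" for t z
    unfolding N_def act_add[symmetric] by (rule haar_mean_right_invariant[where f = "\<lambda>s. \<psi> (act s z)"])
  have cont_N: "continuous_on UNIV N"
    unfolding N_def[abs_def]
    by (intro continuous_on_haar_mean[OF K] continuous_on_compose2[OF \<psi>(1)] continuous_on_action[OF act] continuous_intros) auto
  \<comment> \<open>\<open>N\<close> may vanish on other orbits. The maximum with the constant
    \<open>N y\<close> stays positive, continuous and invariant, dominates \<open>N\<close>, and
    equals \<open>N\<close> on the orbit of \<open>y\<close>.\<close>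
  define L where "L z = max (N y) (N z)" for z
  have L_pos: "0 < L z" for z using N_pos by (simp add: L_def)
  define M where "M z k = complex_haar_mean (\<lambda>s. of_real (\<psi> (act s z)) * \<alpha> s $ i $ k)" for z k
  have M_cont: "continuous_on UNIV (\<lambda>z. M z k)" for k
    unfolding M_def
    by (intro continuous_on_complex_haar_mean[OF K] continuous_intros continuous_on_compose2[OF \<psi>(1)]
        continuous_on_compose2[OF cont_\<alpha>] continuous_on_action[OF act]) auto
  have cont_M: "continuous_on UNIV (\<lambda>s. of_real (\<psi> (act s z)) * \<alpha> s $ i $ k)" for z k
    by (intro continuous_intros cont_\<psi> cont_\<alpha>)
  have cont_Mh: "continuous_on UNIV (\<lambda>s. of_real (\<psi> (act s z)) * \<alpha> (s + t) $ i $ k)" for z t k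
    by (intro continuous_intros cont_\<psi> cont_\<alpha>h)
  \<comment> \<open>Right invariance moves the translation from the point \<open>z\<close> to the
    argument of \<open>\<alpha>\<close>.\<close>
  have M_shift: "M (act (- t) z) k = complex_haar_mean (\<lambda>s. of_real (\<psi> (act s z)) * \<alpha> (s + t) $ i $ k)" for t z k
    using complex_haar_mean_right_invariant[where t = "- t" and f = "\<lambda>s. of_real (\<psi> (act s z)) * \<alpha> (s + t) $ i $ k"]
    by (simp add: M_def act_add[symmetric] add.assoc)
  have M_act: "M (act (- t) z) k = (\<Sum>l\<in>UNIV. M z l * \<alpha> t $ l $ k)" for t z k
  proof -
    have "M (act (- t) z) k = complex_haar_mean (\<lambda>s. \<Sum>l\<in>UNIV. \<alpha> t $ l $ k * (of_real (\<psi> (act s z)) * \<alpha> s $ i $ l))"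
      unfolding M_shift representation_add_nth[OF \<alpha>] sum_distrib_left by (simp add: ac_simps)
    also have "\<dots> = (\<Sum>l\<in>UNIV. complex_haar_mean (\<lambda>s. \<alpha> t $ l $ k * (of_real (\<psi> (act s z)) * \<alpha> s $ i $ l)))"
      by (intro complex_haar_mean_sum[OF K] continuous_on_mult_left cont_M) auto
    also have "\<dots> = (\<Sum>l\<in>UNIV. M z l * \<alpha> t $ l $ k)"
      unfolding M_def complex_haar_mean_cmult[OF K cont_M] by (simp add: mult.commute)
    finally show ?thesis .
  qed
  have M_bound: "norm (M z k) \<le> 2 * (C * N z)" for z k
  proof -
    have "norm (M z k) \<le> 2 * haar_mean (\<lambda>s. C * \<psi> (act s z))"
      unfolding M_def
    proof (intro norm_complex_haar_mean_le[OF K] cont_M continuous_on_mult_left cont_\<psi>)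
      show "norm (of_real (\<psi> (act s z)) * \<alpha> s $ i $ k) \<le> C * \<psi> (act s z)" for s
        using mult_left_mono[OF C \<psi>(2)] \<psi>(2) by (simp add: norm_mult mult.commute)
    qed
    then show ?thesis by (simp add: haar_mean_cmult[OF K cont_\<psi>] N_def)
  qed
  define \<phi> where "\<phi> z k = M z k / of_real (L z)" for z k
  have \<phi>_eq: "\<phi> (act (- t) z) k = (\<Sum>l\<in>UNIV. \<phi> z l * \<alpha> t $ l $ k)" for t z k
    by (simp add: \<phi>_def M_act L_def N_inv sum_divide_distrib)
  moreover have "continuous_on UNIV (\<lambda>z. \<phi> z k)" for k
    unfolding \<phi>_def using L_pos
    by (intro continuous_intros M_cont) (auto simp: L_def intro!: continuous_intros cont_N less_imp_neq[symmetric])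
  ultimately have "\<phi> \<in> equivariant_rows act \<alpha>"
    by (simp add: equivariant_rows_def)
  moreover have "norm (\<phi> z k) \<le> 2 * C" for z k
  proof -
    have "norm (M z k) \<le> 2 * (C * L z)"
      using M_bound[of z k] mult_left_mono[OF max.cobounded2 C0, of "N z" "N y"] by (simp add: L_def)
    then show ?thesis using L_pos[of z] by (simp add: \<phi>_def norm_divide field_simps)
  qed
  moreover have "norm w / 2 \<le> norm (\<phi> (act (- h) y) j - \<phi> y j)"
  proof -
    have cD: "continuous_on UNIV (\<lambda>s. complex_of_real (\<psi> (act s y)) * D s)"
      by (intro continuous_intros cont_\<psi> cont_D)
    \<comment> \<open>The jump of \<open>M\<close> is the mean of \<open>D\<close> weighted by the
      bump, and \<open>w * N y\<close> is that of the constant \<open>w\<close>. The weight vanishes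
      off \<open>W\<close>, so they differ by at most \<open>norm w / 2 * N y\<close>.\<close>
    have "M (act (- h) y) j - M y j = complex_haar_mean (\<lambda>s. of_real (\<psi> (act s y)) * D s)"
      unfolding M_shift M_def[of y] complex_haar_mean_diff[OF K cont_Mh cont_M, symmetric]
      by (simp add: D_def algebra_simps)
    moreover have "w * of_real (N y) = complex_haar_mean (\<lambda>s. w * of_real (\<psi> (act s y)))"
      unfolding N_def complex_haar_mean_of_real[OF K, symmetric]
      by (intro complex_haar_mean_cmult[OF K, symmetric] continuous_intros cont_\<psi>)
    ultimately have "M (act (- h) y) j - M y j - w * of_real (N y) =
        complex_haar_mean (\<lambda>s. of_real (\<psi> (act s y)) * D s - w * of_real (\<psi> (act s y)))"
      by (simp add: complex_haar_mean_diff[OF K cD] continuous_intros cont_\<psi>)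
    moreover have "norm (complex_haar_mean (\<lambda>s. of_real (\<psi> (act s y)) * D s - w * of_real (\<psi> (act s y))))
        \<le> 2 * haar_mean (\<lambda>s. norm w / 4 * \<psi> (act s y))"
    proof (intro norm_complex_haar_mean_le[OF K] continuous_intros cont_\<psi> cont_D)
      fix s
      have "of_real (\<psi> (act s y)) * D s - w * of_real (\<psi> (act s y)) = of_real (\<psi> (act s y)) * (D s - w)"
        by (simp add: algebra_simps)
      then have "norm (of_real (\<psi> (act s y)) * D s - w * of_real (\<psi> (act s y))) = \<psi> (act s y) * norm (D s - w)"
        using \<psi>(2) by (simp add: norm_mult)
      also have "\<dots> \<le> norm w / 4 * \<psi> (act s y)"
      proof (cases "s \<in> W")
        case True
        then show ?thesis using \<psi>(2)[of "act s y"] unfolding mult.commute[of "norm w / 4"]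
          by (intro mult_left_mono) (auto simp: W_def)
      qed (simp add: \<psi>(4))
      finally show "norm (of_real (\<psi> (act s y)) * D s - w * of_real (\<psi> (act s y))) \<le> norm w / 4 * \<psi> (act s y)" .
    qed
    moreover have "haar_mean (\<lambda>s. norm w / 4 * \<psi> (act s y)) = norm w / 4 * N y"
      unfolding N_def by (rule haar_mean_cmult[OF K cont_\<psi>])
    ultimately have "norm (M (act (- h) y) j - M y j - w * of_real (N y)) \<le> 2 * (norm w / 4 * N y)"
      by (simp only:)
    moreover have "norm (w * of_real (N y)) = norm w * N y"
      using N_nonneg by (simp add: norm_mult)
    ultimately have "norm w / 2 * N y \<le> norm (M (act (- h) y) j - M y j)"
      using norm_triangle_ineq4[of "M (act (- h) y) j - M y j" "M (act (- h) y) j - M y j - w * of_real (N y)"]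
      by (simp add: mult.commute)
    moreover have "\<phi> (act (- h) y) j - \<phi> y j = (M (act (- h) y) j - M y j) / of_real (N y)"
      by (simp add: \<phi>_def L_def N_inv diff_divide_distrib)
    ultimately show ?thesis
      by (simp only: norm_divide norm_of_real abs_of_pos[OF N_pos] pos_le_divide_eq[OF N_pos])
  qed
  ultimately show ?thesis by blast
qed

section \<open>From equivariant rows to the isotypic component\<close>

text \<open>\<open>\<Psi>\<close> intertwines \<open>\<alpha>\<close> with translation, and its
  range is the span of the translates of \<open>f\<close>. By irreducibility its kernel is
  everything or zero, giving multiplicity 0 or 1.\<close>

lemma equivariant_row_in_isotypic_component:
  fixes act :: "'g::topological_group_add \<Rightarrow> 'x::topological_space \<Rightarrow> 'x"
    and \<alpha> :: "'g \<Rightarrow> complex ^ 'n ^ 'n"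
  assumes act: "continuous_action act" and \<alpha>: "irreducible_representation \<alpha>"
    and \<phi>: "\<phi> \<in> equivariant_rows act \<alpha>"
  shows "(\<lambda>z. \<phi> z j) \<in> isotypic_component act \<alpha>"
proof -
  define f where "f z = \<phi> z j" for z
  define \<Psi> where "\<Psi> v z = (\<Sum>k\<in>UNIV. \<phi> z k * v $ k)" for v :: "complex ^ 'n" and z
  define S where "S = range (\<lambda>s. translate act s f)"
  have \<Psi>_add: "\<Psi> (u + v) = \<Psi> u + \<Psi> v" for u v
    by (simp add: \<Psi>_def fun_eq_iff algebra_simps sum.distrib)
  have \<Psi>_scale: "\<Psi> (c *s v) = fun_scale c (\<Psi> v)" for c v
    by (simp add: \<Psi>_def fun_scale_def fun_eq_iff sum_distrib_left ac_simps)
  have \<Psi>_0: "\<Psi> 0 = 0" by (simp add: \<Psi>_def fun_eq_iff)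
  have \<Psi>_act: "translate act s (\<Psi> v) = \<Psi> (\<alpha> s *v v)" for s v
  proof
    fix z
    have "translate act s (\<Psi> v) z = (\<Sum>k\<in>UNIV. \<Sum>l\<in>UNIV. \<phi> z l * \<alpha> s $ l $ k * v $ k)"
      using \<phi> by (simp add: translate_def \<Psi>_def equivariant_rows_def sum_distrib_right)
    also have "\<dots> = (\<Sum>l\<in>UNIV. \<Sum>k\<in>UNIV. \<phi> z l * \<alpha> s $ l $ k * v $ k)"
      by (rule sum.swap)
    also have "\<dots> = \<Psi> (\<alpha> s *v v) z"
      by (simp add: \<Psi>_def matrix_vector_mult_def sum_distrib_left mult.assoc)
    finally show "translate act s (\<Psi> v) z = \<Psi> (\<alpha> s *v v) z" .
  qed
  have f_eq: "f = \<Psi> (axis j 1)"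
    by (simp add: f_def \<Psi>_def fun_eq_iff axis_def if_distrib cong: if_cong)
  have translate_translate: "translate act t (translate act s f) = translate act (t + s) f" for s t
  proof -
    have "act (- s + - t) z = act (- s) (act (- t) z)" for z
      using act unfolding continuous_action_def by blast
    then show ?thesis by (simp only: translate_def minus_add)
  qed
  have irr: "V = {0} \<or> V = UNIV" if "vec.subspace V" "\<And>s v. v \<in> V \<Longrightarrow> \<alpha> s *v v \<in> V" for V
    using \<alpha> that unfolding irreducible_representation_def by blast
  have span_translate: "translate act t g \<in> cfun.span S" if "g \<in> cfun.span S" for t g
  proof -
    have "cfun.span S \<subseteq> {g. translate act t g \<in> cfun.span S}"
    proof (rule cfun.span_minimal)
      show "S \<subseteq> {g. translate act t g \<in> cfun.span S}"
        by (auto simp: S_def translate_translate intro: cfun.span_base)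
      have add: "translate act t (p + q) = translate act t p + translate act t q"
        and scale: "translate act t (fun_scale c p) = fun_scale c (translate act t p)"
        and zero: "translate act t 0 = 0" for p q c
        by (simp_all add: translate_def fun_scale_def fun_eq_iff)
      show "cfun.subspace {g. translate act t g \<in> cfun.span S}"
        by (rule cfun.subspaceI) (simp_all add: add scale zero cfun.span_add cfun.span_scale cfun.span_zero)
    qed
    with that show ?thesis by blast
  qed
  have span_eq: "cfun.span S = range \<Psi>"
  proof
    show "cfun.span S \<subseteq> range \<Psi>"
    proof (rule cfun.span_minimal)
      show "S \<subseteq> range \<Psi>" by (auto simp: S_def f_eq \<Psi>_act)
      show "cfun.subspace (range \<Psi>)"
      proof (rule cfun.subspaceI)
        show "0 \<in> range \<Psi>" unfolding \<Psi>_0[symmetric] by (rule rangeI)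
        show "p + q \<in> range \<Psi>" if "p \<in> range \<Psi>" "q \<in> range \<Psi>" for p q
          using that by (auto simp: \<Psi>_add[symmetric])
        show "fun_scale c p \<in> range \<Psi>" if "p \<in> range \<Psi>" for c p
          using that by (auto simp: \<Psi>_scale[symmetric])
      qed
    qed
    \<comment> \<open>The vectors sent into the span form an invariant subspace containing the
      nonzero vector \<open>axis j 1\<close>, hence everything.\<close>
    have "{v. \<Psi> v \<in> cfun.span S} = {0} \<or> {v. \<Psi> v \<in> cfun.span S} = UNIV"
    proof (rule irr)
      show "vec.subspace {v. \<Psi> v \<in> cfun.span S}"
        by (rule vec.subspaceI) (simp_all add: \<Psi>_0 \<Psi>_add \<Psi>_scale cfun.span_add cfun.span_scale cfun.span_zero)
      show "\<alpha> s *v v \<in> {v. \<Psi> v \<in> cfun.span S}" if "v \<in> {v. \<Psi> v \<in> cfun.span S}" for s v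
        using that span_translate by (simp add: \<Psi>_act[symmetric])
    qed
    moreover have "translate act 0 f = f"
      using act by (simp add: translate_def continuous_action_def)
    then have "f \<in> S" unfolding S_def by (metis rangeI)
    then have "\<Psi> (axis j 1) \<in> cfun.span S"
      unfolding f_eq[symmetric] by (rule cfun.span_base)
    moreover have "axis j (1::complex) \<noteq> 0" by (simp add: axis_eq_0_iff)
    ultimately have "{v. \<Psi> v \<in> cfun.span S} = UNIV" by blast
    then show "range \<Psi> \<subseteq> cfun.span S" by blast
  qed
  have "{v. \<Psi> v = 0} = {0} \<or> {v. \<Psi> v = 0} = UNIV"
  proof (rule irr)
    show "vec.subspace {v. \<Psi> v = 0}"
      by (rule vec.subspaceI) (simp_all add: \<Psi>_0 \<Psi>_add \<Psi>_scale)
    show "\<alpha> s *v v \<in> {v. \<Psi> v = 0}" if "v \<in> {v. \<Psi> v = 0}" for s v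
    proof -
      have "translate act s 0 = (0 :: 'x \<Rightarrow> complex)" by (simp add: translate_def fun_eq_iff)
      then show ?thesis using that by (simp add: \<Psi>_act[symmetric])
    qed
  qed
  then have "\<exists>n. rep_isomorphic fun_scale (range \<Psi>) (translate act) tuple_scale (tuples n) (tuple_action \<alpha>)"
  proof
    assume "{v. \<Psi> v = 0} = UNIV"
    then have "\<Psi> v = 0" for v by blast
    then have zero: "range \<Psi> = {0}" by auto
    have "tuples 0 = {0 :: nat \<Rightarrow> complex ^ 'n}"
      by (auto simp: tuples_def fun_eq_iff)
    then have "rep_isomorphic fun_scale (range \<Psi>) (translate act) tuple_scale (tuples 0) (tuple_action \<alpha>)"
      unfolding rep_isomorphic_def zero
      by (intro exI[of _ "\<lambda>_. 0"]) (simp add: bij_betw_def tuple_scale_def tuple_action_def fun_eq_iff)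
    then show ?thesis by blast
  next
    assume ker: "{v. \<Psi> v = 0} = {0}"
    have inj: "inj \<Psi>"
    proof (rule injI)
      fix u v assume "\<Psi> u = \<Psi> v"
      moreover have "\<Psi> u = \<Psi> (u - v) + \<Psi> v" by (simp add: \<Psi>_add[symmetric])
      ultimately have "\<Psi> (u - v) = 0" by simp
      then show "u = v" using ker by (metis (mono_tags) mem_Collect_eq right_minus_eq singletonD)
    qed
    \<comment> \<open>A 1-tuple is a sequence supported at index 0, so \<open>\<Phi>\<close> puts
      the preimage under \<open>\<Psi>\<close> there.\<close>
    define \<Phi> where "\<Phi> p i = (if i = 0 then inv \<Psi> p else 0)" for p and i :: nat
    have \<Phi>: "\<Phi> (\<Psi> v) = (\<lambda>i. if i = 0 then v else 0)" for v
      by (simp add: \<Phi>_def fun_eq_iff inv_f_f[OF inj])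
    have "bij_betw \<Phi> (range \<Psi>) (tuples 1)"
      unfolding bij_betw_def
    proof
      show "inj_on \<Phi> (range \<Psi>)"
        by (rule inj_onI) (auto simp: \<Phi> fun_eq_iff split: if_splits)
      have "v \<in> \<Phi> ` range \<Psi>" if "v \<in> tuples 1" for v
      proof -
        have "v = \<Phi> (\<Psi> (v 0))" using that by (auto simp: \<Phi> tuples_def fun_eq_iff)
        then show ?thesis by blast
      qed
      then show "\<Phi> ` range \<Psi> = tuples 1" by (auto simp: \<Phi> tuples_def)
    qed
    then have "rep_isomorphic fun_scale (range \<Psi>) (translate act) tuple_scale (tuples 1) (tuple_action \<alpha>)"
      unfolding rep_isomorphic_def
      by (intro exI[of _ \<Phi>])
        (auto simp: \<Psi>_add[symmetric] \<Psi>_scale[symmetric] \<Psi>_act \<Phi> tuple_scale_def tuple_action_def fun_eq_iff)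
    then show ?thesis by blast
  qed
  moreover have "f \<in> continuous_functions"
    using \<phi> by (simp add: continuous_functions_def equivariant_rows_def f_def[abs_def])
  ultimately show ?thesis
    unfolding isotypic_component_def S_def[symmetric, unfolded f_def] mem_Collect_eq
    using span_eq unfolding S_def f_def[abs_def] by simp
qed

lemma equivariant_rows_scale:
  assumes "\<phi> \<in> equivariant_rows act \<alpha>"
  shows "(\<lambda>z k. c * \<phi> z k) \<in> equivariant_rows act \<alpha>"
  using assms by (auto simp: equivariant_rows_def sum_distrib_left mult.assoc intro!: continuous_intros)

text \<open>Continuity is the Weierstrass test; equivariance survives because the sum over matrix
  indices is finite and can be exchanged with the series.\<close>

lemma equivariant_rows_suminf:
  fixes \<phi> :: "nat \<Rightarrow> 'x::topological_space \<Rightarrow> 'n::finite \<Rightarrow> complex"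
  assumes \<phi>: "\<And>m. \<phi> m \<in> equivariant_rows act \<alpha>" and M: "summable M"
    and le: "\<And>m z k. norm (\<phi> m z k) \<le> M m"
  shows "(\<lambda>z k. \<Sum>m. \<phi> m z k) \<in> equivariant_rows act \<alpha>"
proof -
  have summable: "summable (\<lambda>m. \<phi> m z k)" for z k
    by (rule summable_comparison_test'[OF M, of 0]) (rule le)
  have "continuous_on UNIV (\<lambda>z. \<Sum>m. \<phi> m z k)" for k
  proof (rule uniform_limit_theorem)
    show "uniform_limit UNIV (\<lambda>n z. \<Sum>m<n. \<phi> m z k) (\<lambda>z. \<Sum>m. \<phi> m z k) sequentially"
      using le M by (intro Weierstrass_m_test) auto
    show "\<forall>\<^sub>F n in sequentially. continuous_on UNIV (\<lambda>z. \<Sum>m<n. \<phi> m z k)"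
      using \<phi> by (intro always_eventually allI continuous_on_sum) (simp add: equivariant_rows_def)
  qed simp
  moreover have "(\<Sum>m. \<phi> m (act (- s) z) j) = (\<Sum>k\<in>UNIV. (\<Sum>m. \<phi> m z k) * \<alpha> s $ k $ j)" for s z j
  proof -
    have "(\<Sum>m. \<phi> m (act (- s) z) j) = (\<Sum>m. \<Sum>k\<in>UNIV. \<phi> m z k * \<alpha> s $ k $ j)"
      using \<phi> by (simp add: equivariant_rows_def)
    also have "\<dots> = (\<Sum>k\<in>UNIV. \<Sum>m. \<phi> m z k * \<alpha> s $ k $ j)"
      by (intro suminf_sum summable_mult2 summable)
    finally show ?thesis by (simp add: suminf_mult2[OF summable])
  qed
  ultimately show ?thesis by (simp add: equivariant_rows_def)
qed

section \<open>The gliding hump\<close>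

text \<open>
  Sokal's trick from the proof of the uniform boundedness principle: the norms of \<open>a + b\<close> and
  \<open>a - b\<close> cannot both be smaller than the norm of \<open>b\<close>, so the sign of each term can be chosen after
  the previous ones.
\<close>

lemma signed_series_lower_bound:
  fixes t :: "nat \<Rightarrow> nat \<Rightarrow> complex"
  assumes t: "\<And>n k. norm (t n k) \<le> K" and diag: "\<And>n. d \<le> norm (t n n)" and d: "0 < d"
    and r: "r = d / (4 * K)"
  shows "\<exists>\<epsilon> :: nat \<Rightarrow> real. (\<forall>k. \<bar>\<epsilon> k\<bar> = 1) \<and>
           (\<forall>n. r ^ n * d / 2 \<le> norm (\<Sum>k. of_real (\<epsilon> k * r ^ k) * t n k))"
proof -
  have "d \<le> K" using t[of 0 0] diag[of 0] by linarith
  \<comment> \<open>The ratio is chosen so that \<open>K * r = d / 4\<close>: each tail is then at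
    most half of the term it follows.\<close>
  then have r01: "0 < r" "r \<le> 1 / 4" "K * r = d / 4" using d by (auto simp: r field_simps)
  let ?P = "\<lambda>f n e. \<bar>e\<bar> = (1 :: real) \<and>
    r ^ n * d \<le> norm ((\<Sum>k<n. of_real (f k * r ^ k) * t n k) + of_real (e * r ^ n) * t n n)"
  \<comment> \<open>The condition on the \<open>n\<close>-th sign involves only earlier signs, so
    recursive choice applies.\<close>
  have "\<exists>\<epsilon>. \<forall>n. ?P \<epsilon> n (\<epsilon> n)"
  proof (rule dependent_wellorder_choice)
    fix f n
    let ?a = "\<Sum>k<n. of_real (f k * r ^ k) * t n k" and ?b = "of_real (r ^ n) * t n n"
    have "norm (?a + ?b - (?a - ?b)) \<le> norm (?a + ?b) + norm (?a - ?b)" by (rule norm_triangle_ineq4)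
    then have "2 * norm ?b \<le> norm (?a + ?b) + norm (?a - ?b)"
      by (simp add: norm_mult flip: mult_2)
    moreover have "r ^ n * d \<le> norm ?b"
      using diag[of n] r01(1) by (simp add: norm_mult norm_power)
    ultimately have "r ^ n * d \<le> norm (?a + ?b) \<or> r ^ n * d \<le> norm (?a - ?b)" by linarith
    then have "?P f n 1 \<or> ?P f n (-1)" by simp
    then show "\<exists>e. ?P f n e" by blast
  next
    fix e :: real and f g :: "nat \<Rightarrow> real" and n
    assume "\<And>k. k < n \<Longrightarrow> f k = g k"
    then have "(\<Sum>k<n. of_real (f k * r ^ k) * t n k) = (\<Sum>k<n. of_real (g k * r ^ k) * t n k)"
      by (intro sum.cong) auto
    then show "?P f n e = ?P g n e" by simp
  qed
  then obtain \<epsilon> :: "nat \<Rightarrow> real" where \<epsilon>: "\<And>n. \<bar>\<epsilon> n\<bar> = 1"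
    "\<And>n. r ^ n * d \<le> norm ((\<Sum>k<n. of_real (\<epsilon> k * r ^ k) * t n k) + of_real (\<epsilon> n * r ^ n) * t n n)"
    by blast
  have "r ^ n * d / 2 \<le> norm (\<Sum>k. of_real (\<epsilon> k * r ^ k) * t n k)" for n
  proof -
    let ?u = "\<lambda>k. of_real (\<epsilon> k * r ^ k) * t n k"
    have u: "norm (?u k) \<le> K * r ^ k" for k
      using mult_left_mono[OF t[of n k], of "r ^ k"] r01(1) \<epsilon>(1)[of k]
      by (simp add: norm_mult norm_power mult.commute)
    have geo: "summable (\<lambda>k. K * r ^ k)"
      using r01 by (intro summable_mult summable_geometric) auto
    have su: "summable ?u" using u by (intro summable_comparison_test'[OF geo]) auto
    \<comment> \<open>The tail starts at \<open>n + 1\<close>, which supplies the extra factor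
      \<open>r\<close>; since \<open>1 / (1 - r) \<le> 2\<close>, it costs at most half of
      \<open>r ^ n * d\<close>.\<close>
    have "norm (\<Sum>k. ?u (k + Suc n)) \<le> (\<Sum>k. K * r * r ^ n * r ^ k)"
    proof (rule norm_suminf_le)
      show "norm (?u (k + Suc n)) \<le> K * r * r ^ n * r ^ k" for k
        using u[of "k + Suc n"] by (simp add: power_add ac_simps)
      show "summable (\<lambda>k. K * r * r ^ n * r ^ k)"
        using r01 by (intro summable_mult summable_geometric) auto
    qed
    also have "\<dots> = K * r * r ^ n * (\<Sum>k. r ^ k)"
      using r01 by (intro suminf_mult summable_geometric) auto
    also have "\<dots> = d / 4 * r ^ n * (1 / (1 - r))"
      unfolding r01(3) using r01(1,2) by (simp add: suminf_geometric)
    also have "\<dots> \<le> d / 4 * r ^ n * 2"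
      using r01 d by (intro mult_left_mono) (auto simp: field_simps)
    finally have tail: "norm (\<Sum>k. ?u (k + Suc n)) \<le> r ^ n * d / 2" by (simp add: mult.commute)
    have "suminf ?u = (\<Sum>k. ?u (k + Suc n)) + ((\<Sum>k<n. ?u k) + ?u n)"
      using suminf_split_initial_segment[OF su, of "Suc n"] by simp
    then have "norm ((\<Sum>k<n. ?u k) + ?u n) \<le> norm (suminf ?u) + norm (\<Sum>k. ?u (k + Suc n))"
      using norm_triangle_ineq4[of "suminf ?u" "\<Sum>k. ?u (k + Suc n)"] by simp
    then show ?thesis using \<epsilon>(2)[of n] tail by simp
  qed
  with \<epsilon>(1) show ?thesis by blast
qed

section \<open>Finite generation against the hump\<close>

lemma sum_fun_apply:
  fixes f :: "'i \<Rightarrow> 'x \<Rightarrow> 'b::comm_monoid_add"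
  shows "(\<Sum>i\<in>I. f i) z = (\<Sum>i\<in>I. f i z)"
  by (induction I rule: infinite_finite_induct) auto

lemma bounded_on_compact_space:
  fixes f :: "'x::topological_space \<Rightarrow> 'b::real_normed_vector"
  assumes "compact (UNIV :: 'x set)" "continuous_on UNIV f"
  shows "\<exists>B. \<forall>z. norm (f z) \<le> B"
  using compact_imp_bounded[OF compact_continuous_image[OF assms(2,1)]] by (auto simp: bounded_iff)

text \<open>
  Invariant coefficients cannot distinguish \<open>act (- h) y\<close> from \<open>y\<close>, so the difference of a function
  between these points is controlled by that of the generators.
\<close>

lemma generated_difference_bound:
  fixes act :: "'g::uminus \<Rightarrow> 'x::topological_space \<Rightarrow> 'x"
  assumes X: "compact (UNIV :: 'x set)" and F: "finite F"
    and a: "\<And>g. g \<in> F \<Longrightarrow> a g \<in> invariant_functions act"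
  shows "\<exists>B. \<forall>y h. norm ((\<Sum>g\<in>F. a g * g) (act (- h) y) - (\<Sum>g\<in>F. a g * g) y)
           \<le> B * (\<Sum>g\<in>F. norm (g (act (- h) y) - g y))"
proof -
  have "\<exists>B. \<forall>z. norm (a g z) \<le> B" if "g \<in> F" for g
    using a[OF that] bounded_on_compact_space[OF X] by (auto simp: invariant_functions_def continuous_functions_def)
  then obtain b where b: "\<And>g z. g \<in> F \<Longrightarrow> norm (a g z) \<le> b g" by metis
  have b0: "0 \<le> b g" if "g \<in> F" for g
    using b[OF that] norm_ge_zero order_trans by blast
  show ?thesis
  proof (intro exI allI)
    fix y h
    have inv: "a g (act (- h) y) = a g y" if "g \<in> F" for g
    proof -
      have "translate act h (a g) = a g" using a[OF that] by (simp add: invariant_functions_def)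
      then show ?thesis unfolding translate_def by (rule fun_cong)
    qed
    have "(\<Sum>g\<in>F. a g * g) (act (- h) y) - (\<Sum>g\<in>F. a g * g) y = (\<Sum>g\<in>F. a g y * (g (act (- h) y) - g y))"
      unfolding sum_fun_apply sum_subtractf[symmetric]
      by (intro sum.cong) (simp_all add: inv right_diff_distrib)
    also have "norm \<dots> \<le> (\<Sum>g\<in>F. b g * norm (g (act (- h) y) - g y))"
      by (rule order_trans[OF norm_sum])
         (auto simp: norm_mult intro!: sum_mono mult_right_mono b)
    \<comment> \<open>The bounds \<open>b g\<close> are nonnegative, so their sum dominates each of
      them and gives one constant for all points.\<close>
    also have "\<dots> \<le> (\<Sum>g\<in>F. sum b F * norm (g (act (- h) y) - g y))"
      using F b0 by (intro sum_mono mult_right_mono member_le_sum) auto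
    finally show "norm ((\<Sum>g\<in>F. a g * g) (act (- h) y) - (\<Sum>g\<in>F. a g * g) y)
        \<le> sum b F * (\<Sum>g\<in>F. norm (g (act (- h) y) - g y))"
      by (simp add: sum_distrib_left)
  qed
qed

theorem corollary1p8:
  fixes act :: "'g::{topological_group_add, t2_space} \<Rightarrow> 'x::t2_space \<Rightarrow> 'x"
    and \<alpha> :: "'g \<Rightarrow> complex ^ 'n ^ 'n"
    and x :: 'x
  assumes "compact (UNIV :: 'g set)"
    and "compact (UNIV :: 'x set)"
    and "continuous_action act"
    and "x \<in> closure (free_points act)"
    and "irreducible_representation \<alpha>"
    and "\<not> acts_trivially \<alpha> (isotropy act x)"
  shows "\<not> finitely_generated_over (invariant_functions act) (isotypic_component act \<alpha>)"
proof
  note K = assms(1) and X = assms(2) and act = assms(3)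
  assume "finitely_generated_over (invariant_functions act) (isotypic_component act \<alpha>)"
  then obtain F where F: "finite F" "F \<subseteq> isotypic_component act \<alpha>"
    and gen: "\<And>f. f \<in> isotypic_component act \<alpha> \<Longrightarrow>
      \<exists>a. (\<forall>g\<in>F. a g \<in> invariant_functions act) \<and> f = (\<Sum>g\<in>F. a g * g)"
    unfolding finitely_generated_over_def by blast
  have \<alpha>: "representation \<alpha>" using assms(5) by (simp add: irreducible_representation_def)
  obtain h v where h: "act h x = x" "\<alpha> h *v v \<noteq> v"
    using assms(6) by (auto simp: acts_trivially_def isotropy_def)
  \<comment> \<open>The jump is taken at \<open>- h\<close>, matching the convention for equivariant
    rows. Since \<open>- h\<close> also fixes \<open>x\<close>, every jump vanishes at
    \<open>x\<close>.\<close>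
  have hx: "act (- h) x = x"
  proof -
    have "act (- h + h) x = act (- h) (act h x)" "act 0 x = x"
      using act unfolding continuous_action_def by blast+
    then show ?thesis by (simp add: h(1))
  qed
  have "\<alpha> h \<noteq> mat 1" using h(2) by auto
  then obtain i j where "\<alpha> h $ i $ j \<noteq> mat 1 $ i $ j" by (auto simp: vec_eq_iff)
  then obtain w where w: "w = \<alpha> h $ i $ j - mat 1 $ i $ j" "w \<noteq> 0" by simp
  obtain C where C: "\<And>s k. norm (\<alpha> s $ i $ k) \<le> C"
  proof -
    have "continuous_on UNIV \<alpha>" using \<alpha> by (simp add: representation_def)
    then obtain B where B: "\<And>s. norm (\<alpha> s) \<le> B"
      using bounded_on_compact_space[OF K] by blast
    have "norm (\<alpha> s $ i $ k) \<le> B" for s k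
      using Finite_Cartesian_Product.norm_nth_le[of "\<alpha> s" i] Finite_Cartesian_Product.norm_nth_le[of "\<alpha> s $ i" k] B[of s] by linarith
    then show ?thesis by (rule that)
  qed
  define jump where "jump y f = f (act (- h) y) - f y" for y and f :: "'x \<Rightarrow> complex"
  define G where "G y = (\<Sum>g\<in>F. norm (jump y g))" for y
  define d where "d = norm w / 2"
  have d: "0 < d" using w by (simp add: d_def)
  \<comment> \<open>This is the ratio of the signed series lemma with \<open>K = 4 * C\<close>, the
    bound on the jump of a function bounded by \<open>2 * C\<close>.\<close>
  define r where "r = d / (4 * (4 * C))"
  have hump: "\<exists>\<phi>\<in>equivariant_rows act \<alpha>. (\<forall>z k. norm (\<phi> z k) \<le> 2 * C) \<and> d \<le> norm (jump y (\<lambda>z. \<phi> z j))"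
    if "y \<in> free_points act" for y
    using equivariant_row_oscillating_at_free_point[OF K X act \<alpha> that C w] by (simp add: jump_def d_def)
  have jump_le: "norm (jump y f) \<le> 4 * C" if "\<And>z. norm (f z) \<le> 2 * C" for y f
    using norm_triangle_ineq4[of "f (act (- h) y)" "f y"] that[of y] that[of "act (- h) y"] by (simp add: jump_def)
  \<comment> \<open>One hump suffices to show \<open>d \<le> 4 * C\<close>, which makes
    \<open>C\<close> positive and \<open>r\<close> less than 1.\<close>
  have "free_points act \<noteq> {}" using assms(4) by auto
  then obtain y \<phi> where "\<And>z k. norm (\<phi> z k) \<le> 2 * C" "d \<le> norm (jump y (\<lambda>z. \<phi> z j))"
    using hump by blast
  then have "d \<le> 4 * C" using jump_le[of "\<lambda>z. \<phi> z j" y] by simp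
  then have C_pos: "0 < C" and r: "0 < r" "r < 1" using d by (auto simp: r_def field_simps)
  have cont_G: "continuous_on UNIV G"
  proof -
    have "continuous_on UNIV (\<lambda>y. g (act (- h) y) - g y)" if "g \<in> F" for g
    proof -
      have g: "continuous_on UNIV g"
        using F(2) that by (auto simp: isotypic_component_def continuous_functions_def)
      have "continuous_on UNIV (act (- h))"
        using continuous_on_action[OF act continuous_on_const continuous_on_id] by simp
      then have "continuous_on UNIV (\<lambda>y. g (act (- h) y))"
        by (rule continuous_on_compose2[OF g]) simp
      then show ?thesis by (rule continuous_on_diff[OF _ g])
    qed
    then show ?thesis unfolding G_def jump_def by (intro continuous_on_sum continuous_on_norm) auto
  qed
  have "\<exists>y\<in>free_points act. G y < e" if "0 < e" for e
  proof -
    have "open {y. G y < e}" by (intro open_Collect_less cont_G continuous_intros)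
    moreover have "x \<in> {y. G y < e}" using that by (simp add: G_def jump_def hx)
    ultimately have "free_points act \<inter> {y. G y < e} \<noteq> {}"
      using assms(4) open_Int_closure_eq_empty[of "{y. G y < e}" "free_points act"] by blast
    then show ?thesis by blast
  qed
  \<comment> \<open>The threshold lies below the coming lower bound \<open>r ^ n * d / 2\<close> by
    the unbounded factor \<open>2 * (n + 1)\<close>.\<close>
  then have "\<exists>y\<in>free_points act. G y < r ^ n * d / (4 * real (Suc n))" for n
    using r d by simp
  then obtain Y where Y: "\<And>n. Y n \<in> free_points act" "\<And>n. G (Y n) < r ^ n * d / (4 * real (Suc n))"
    by metis
  obtain \<theta> where \<theta>: "\<And>n. \<theta> n \<in> equivariant_rows act \<alpha>" "\<And>n z k. norm (\<theta> n z k) \<le> 2 * C"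
    "\<And>n. d \<le> norm (jump (Y n) (\<lambda>z. \<theta> n z j))"
    using hump[OF Y(1)] by metis
  obtain \<epsilon> :: "nat \<Rightarrow> real" where \<epsilon>: "\<And>k. \<bar>\<epsilon> k\<bar> = 1"
    "\<And>n. r ^ n * d / 2 \<le> norm (\<Sum>k. of_real (\<epsilon> k * r ^ k) * jump (Y n) (\<lambda>z. \<theta> k z j))"
    using signed_series_lower_bound[where t = "\<lambda>n k. jump (Y n) (\<lambda>z. \<theta> k z j)", OF jump_le[OF \<theta>(2)] \<theta>(3) d r_def] by blast
  \<comment> \<open>A single series carries all humps: its jump at each \<open>Y n\<close> is at
    least \<open>r ^ n * d / 2\<close>.\<close>
  define f where "f z = (\<Sum>k. of_real (\<epsilon> k * r ^ k) * \<theta> k z j)" for z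
  have le: "norm (of_real (\<epsilon> k * r ^ k) * \<theta> k z l) \<le> 2 * C * r ^ k" for k z l
    using mult_left_mono[OF \<theta>(2)[of k z l], of "r ^ k"] r \<epsilon>(1)[of k]
    by (simp add: norm_mult norm_power mult.commute)
  have geo: "summable (\<lambda>k. 2 * C * r ^ k)"
    using r by (intro summable_mult summable_geometric) auto
  have "f \<in> isotypic_component act \<alpha>"
    unfolding f_def[abs_def]
    by (intro equivariant_row_in_isotypic_component[OF act assms(5)]
        equivariant_rows_suminf[OF _ geo le] equivariant_rows_scale \<theta>(1))
  then obtain a where a: "\<And>g. g \<in> F \<Longrightarrow> a g \<in> invariant_functions act" "f = (\<Sum>g\<in>F. a g * g)"
    using gen by blast
  obtain B where B: "\<And>y. norm (jump y f) \<le> B * G y"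
    using generated_difference_bound[OF X F(1), where a = a and act = act, OF a(1)] unfolding a(2)[symmetric] jump_def G_def by blast
  \<comment> \<open>Comparing the lower bound on the jump at \<open>Y n\<close> with
    \<open>B * G (Y n)\<close> forces the fixed constant \<open>B\<close> above every multiple
    \<open>2 * (n + 1)\<close>.\<close>
  have B_large: "2 * real (Suc n) \<le> B" for n
  proof -
    have su: "summable (\<lambda>k. of_real (\<epsilon> k * r ^ k) * \<theta> k z j)" for z
      by (rule summable_comparison_test'[OF geo, of 0]) (rule le)
    have "jump (Y n) f = (\<Sum>k. of_real (\<epsilon> k * r ^ k) * jump (Y n) (\<lambda>z. \<theta> k z j))"
      unfolding jump_def f_def suminf_diff[OF su su] by (simp only: right_diff_distrib)
    then have "r ^ n * d / 2 \<le> B * G (Y n)" using \<epsilon>(2)[of n] B[of "Y n"] by simp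
    moreover have "0 < r ^ n * d" using r d by simp
    moreover have "0 \<le> G (Y n)" by (simp add: G_def sum_nonneg)
    \<comment> \<open>Positivity of \<open>B\<close> is what allows the upper bound on
      \<open>G (Y n)\<close> to be multiplied by it.\<close>
    ultimately have "0 < B"
      using mult_nonpos_nonneg[of B "G (Y n)"] by linarith
    then have "B * G (Y n) \<le> B * (r ^ n * d / (4 * real (Suc n)))"
      using Y(2)[of n] by (intro mult_left_mono) auto
    with \<open>r ^ n * d / 2 \<le> B * G (Y n)\<close> have "r ^ n * d / 2 \<le> B * (r ^ n * d / (4 * real (Suc n)))"
      by linarith
    then have "r ^ n * d * (2 * real (Suc n)) \<le> r ^ n * d * B"
      by (simp add: field_simps del: of_nat_Suc)
    then show ?thesis using \<open>0 < r ^ n * d\<close> by (rule mult_left_le_imp_le)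
  qed
  obtain n where "B < real n" using reals_Archimedean2 by blast
  with B_large[of n] show False by simp
qed

end
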